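(* Let $\mathcal T$ be a strict tensor $W^*$-category equipped with a faithful idempotent tensor $^*$-functor $\iota$ into a tensor subcategory of Hilbert spaces (in the precise sense of the context). If $\mathcal T$ has a right regular object, then there is a multiplicative unitary $V$ such that $\mathcal T$ is isomorphic, as a tensor $W^*$-category, to a tensor $^*$-subcategory of the category $\mathcal R(V)$ of representations of $V$.
   Context: Notation: $(X,Y)$ denotes the arrows from $X$ to $Y$, $\circ$ composition, $\times$ the tensor product on objects and arrows ($\times$ is evaluated before $\circ$), $1_X$ identities, $\mathbb C$ the tensor unit. Hilbert spaces are taken as objects of a strict tensor $W^*$-category of Hilbert spaces (e.g. the Hilbert spaces in a fixed von Neumann algebra); there the tensor product of $H,K$ is written $HK$, and $\vartheta$ is the flip. Setting for $\mathcal T$: $\iota:\mathcal T\to\mathcal T$ is a faithful tensor $^*$-functor with $\iota^2=\iota$, and $\iota(\mathcal T)$ is a tensor $W^*$-category of Hilbert spaces: $(\mathbb C,\mathbb C)$ is the complex numbers and every object is a (possibly infinite) direct sum of $\mathbb C$. $\iota(\mathcal T)$ has its permutation symmetry $\vartheta$, and for all objects $W,W'$ of $\mathcal T$ there are (necessarily unique) arrows $\vartheta_{W,\iota(W')}\in(W\times\iota(W'),\iota(W')\times W)$ and $\vartheta_{\iota(W),W'}\in(\iota(W)\times W',W'\times\iota(W))$ whose image under $\iota$ is $\vartheta_{\iota(W),\iota(W')}$. Right regular object: a pair $(V,\eta)$ with $V$ an object of $\mathcal T$, $R$ the functor of tensoring on the right by $V$, and $\eta\in(R,R\iota)$ a unitary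 natural transformation, i.e. unitaries $\eta_W\in(W\times V,\iota(W)\times V)$ natural in $W$, such that for all objects $W,W'$ $$\eta_{W\times W'}=(\eta_W)_{13}\circ 1_W\times\eta_{W'},\qquad (\eta_W)_{13}:=1_{\iota(W)}\times\vartheta_{V,\iota(W')}\circ\eta_W\times 1_{\iota(W')}\circ 1_W\times\vartheta_{\iota(W'),V}.$$ Multiplicative unitary on a Hilbert space $K$: a unitary $V\in(K^2,K^2)$ with $V_{12}V_{13}V_{23}=V_{23}V_{12}$ on $K^3$ (usual leg notation). Representation of $V$ on $H$: a unitary $W\in(HK,HK)$ with $W_{12}W_{13}V_{23}=V_{23}W_{12}$ on $HK^2$. $\mathcal R(V)$ has the representations as objects, arrows $T\in(W,W')$ the bounded $T:H\to H'$ with $(T\times 1_K)W=W'(T\times 1_K)$, and tensor product $W\times W':=W_{13}W'_{23}$ on $HH'$, with the usual tensor product of operators on arrows. *)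

theory Defs
  imports "HOL-Analysis.Infinite_Sum"
begin

section \<open>Strict tensor W*-categories\<close>

text \<open>
  \<open>Hom C A B\<close> is the space of arrows written \<open>(A,B)\<close> in the operator-algebra literature. Hom-sets
  need not be disjoint: in a category of representations one and the same operator may be an arrow
  between several pairs of objects. The operations are required to behave well only on objects
  and on (composable) arrows.
\<close>

record ('o, 'a) tensor_category =
  Obj :: "'o set"
  Hom :: "'o \<Rightarrow> 'o \<Rightarrow> 'a set"
  Comp :: "'a \<Rightarrow> 'a \<Rightarrow> 'a" (infixl \<open>\<cdot>\<index>\<close> 65)
  Ident :: "'o \<Rightarrow> 'a" (\<open>\<one>\<index>\<close>)
  Zero :: "'o \<Rightarrow> 'o \<Rightarrow> 'a" (\<open>\<zero>\<index>\<close>)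
  Add :: "'a \<Rightarrow> 'a \<Rightarrow> 'a" (infixl \<open>\<oplus>\<index>\<close> 60)
  Scale :: "complex \<Rightarrow> 'a \<Rightarrow> 'a" (infixr \<open>\<odot>\<index>\<close> 75)
  Adj :: "'a \<Rightarrow> 'a" (\<open>_\<^sup>\<star>\<index>\<close> [1000] 999)
  Norm :: "'a \<Rightarrow> real"
  Unit :: "'o"
  TensorO :: "'o \<Rightarrow> 'o \<Rightarrow> 'o" (infixl \<open>\<boxtimes>\<index>\<close> 70)
  TensorA :: "'a \<Rightarrow> 'a \<Rightarrow> 'a" (infixl \<open>\<otimes>\<index>\<close> 70)

locale complex_star_category =
  fixes C :: "('o, 'a) tensor_category" (structure)
  assumes ident_hom: "A \<in> Obj C \<Longrightarrow> \<one> A \<in> Hom C A A"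
    and comp_hom: "\<lbrakk>A \<in> Obj C; B \<in> Obj C; D \<in> Obj C; t \<in> Hom C A B; s \<in> Hom C B D\<rbrakk>
      \<Longrightarrow> s \<cdot> t \<in> Hom C A D"
    and comp_assoc: "\<lbrakk>A \<in> Obj C; B \<in> Obj C; D \<in> Obj C; E \<in> Obj C;
        t \<in> Hom C A B; s \<in> Hom C B D; r \<in> Hom C D E\<rbrakk> \<Longrightarrow> (r \<cdot> s) \<cdot> t = r \<cdot> (s \<cdot> t)"
    and ident_left: "\<lbrakk>A \<in> Obj C; B \<in> Obj C; t \<in> Hom C A B\<rbrakk> \<Longrightarrow> \<one> B \<cdot> t = t"
    and ident_right: "\<lbrakk>A \<in> Obj C; B \<in> Obj C; t \<in> Hom C A B\<rbrakk> \<Longrightarrow> t \<cdot> \<one> A = t"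
    \<comment> \<open>hom-sets are complex vector spaces; additive inverses are \<open>(-1) \<odot> t\<close>\<close>
    and zero_hom: "\<lbrakk>A \<in> Obj C; B \<in> Obj C\<rbrakk> \<Longrightarrow> \<zero> A B \<in> Hom C A B"
    and add_hom: "\<lbrakk>A \<in> Obj C; B \<in> Obj C; s \<in> Hom C A B; t \<in> Hom C A B\<rbrakk> \<Longrightarrow> s \<oplus> t \<in> Hom C A B"
    and scale_hom: "\<lbrakk>A \<in> Obj C; B \<in> Obj C; t \<in> Hom C A B\<rbrakk> \<Longrightarrow> c \<odot> t \<in> Hom C A B"
    and add_assoc: "\<lbrakk>A \<in> Obj C; B \<in> Obj C; r \<in> Hom C A B; s \<in> Hom C A B; t \<in> Hom C A B\<rbrakk>
      \<Longrightarrow> (r \<oplus> s) \<oplus> t = r \<oplus> (s \<oplus> t)"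
    and add_commute: "\<lbrakk>A \<in> Obj C; B \<in> Obj C; s \<in> Hom C A B; t \<in> Hom C A B\<rbrakk> \<Longrightarrow> s \<oplus> t = t \<oplus> s"
    and add_zero: "\<lbrakk>A \<in> Obj C; B \<in> Obj C; t \<in> Hom C A B\<rbrakk> \<Longrightarrow> t \<oplus> \<zero> A B = t"
    and add_inverse: "\<lbrakk>A \<in> Obj C; B \<in> Obj C; t \<in> Hom C A B\<rbrakk> \<Longrightarrow> t \<oplus> (-1) \<odot> t = \<zero> A B"
    and scale_one: "\<lbrakk>A \<in> Obj C; B \<in> Obj C; t \<in> Hom C A B\<rbrakk> \<Longrightarrow> 1 \<odot> t = t"
    and scale_scale: "\<lbrakk>A \<in> Obj C; B \<in> Obj C; t \<in> Hom C A B\<rbrakk> \<Longrightarrow> c \<odot> (d \<odot> t) = (c * d) \<odot> t"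
    and scale_add_right: "\<lbrakk>A \<in> Obj C; B \<in> Obj C; s \<in> Hom C A B; t \<in> Hom C A B\<rbrakk>
      \<Longrightarrow> c \<odot> (s \<oplus> t) = c \<odot> s \<oplus> c \<odot> t"
    and scale_add_left: "\<lbrakk>A \<in> Obj C; B \<in> Obj C; t \<in> Hom C A B\<rbrakk> \<Longrightarrow> (c + d) \<odot> t = c \<odot> t \<oplus> d \<odot> t"
    \<comment> \<open>composition is bilinear\<close>
    and comp_add_left: "\<lbrakk>A \<in> Obj C; B \<in> Obj C; D \<in> Obj C; t \<in> Hom C A B; r \<in> Hom C B D; s \<in> Hom C B D\<rbrakk>
      \<Longrightarrow> (r \<oplus> s) \<cdot> t = (r \<cdot> t) \<oplus> (s \<cdot> t)"
    and comp_add_right: "\<lbrakk>A \<in> Obj C; B \<in> Obj C; D \<in> Obj C; s \<in> Hom C A B; t \<in> Hom C A B; r \<in> Hom C B D\<rbrakk>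
      \<Longrightarrow> r \<cdot> (s \<oplus> t) = (r \<cdot> s) \<oplus> (r \<cdot> t)"
    and comp_scale_left: "\<lbrakk>A \<in> Obj C; B \<in> Obj C; D \<in> Obj C; t \<in> Hom C A B; s \<in> Hom C B D\<rbrakk>
      \<Longrightarrow> (c \<odot> s) \<cdot> t = c \<odot> (s \<cdot> t)"
    and comp_scale_right: "\<lbrakk>A \<in> Obj C; B \<in> Obj C; D \<in> Obj C; t \<in> Hom C A B; s \<in> Hom C B D\<rbrakk>
      \<Longrightarrow> s \<cdot> (c \<odot> t) = c \<odot> (s \<cdot> t)"
    \<comment> \<open>the adjoint is an antilinear, involutive, contravariant functor, the identity on objects\<close>
    and adj_hom: "\<lbrakk>A \<in> Obj C; B \<in> Obj C; t \<in> Hom C A B\<rbrakk> \<Longrightarrow> t\<^sup>\<star> \<in> Hom C B A"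
    and adj_adj: "\<lbrakk>A \<in> Obj C; B \<in> Obj C; t \<in> Hom C A B\<rbrakk> \<Longrightarrow> (t\<^sup>\<star>)\<^sup>\<star> = t"
    and adj_comp: "\<lbrakk>A \<in> Obj C; B \<in> Obj C; D \<in> Obj C; t \<in> Hom C A B; s \<in> Hom C B D\<rbrakk>
      \<Longrightarrow> (s \<cdot> t)\<^sup>\<star> = t\<^sup>\<star> \<cdot> s\<^sup>\<star>"
    and adj_add: "\<lbrakk>A \<in> Obj C; B \<in> Obj C; s \<in> Hom C A B; t \<in> Hom C A B\<rbrakk> \<Longrightarrow> (s \<oplus> t)\<^sup>\<star> = s\<^sup>\<star> \<oplus> t\<^sup>\<star>"
    and adj_scale: "\<lbrakk>A \<in> Obj C; B \<in> Obj C; t \<in> Hom C A B\<rbrakk> \<Longrightarrow> (c \<odot> t)\<^sup>\<star> = cnj c \<odot> t\<^sup>\<star>"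

locale Cstar_category = complex_star_category +
  assumes norm_eq_zero: "\<lbrakk>A \<in> Obj C; B \<in> Obj C; t \<in> Hom C A B\<rbrakk> \<Longrightarrow> Norm C t = 0 \<longleftrightarrow> t = \<zero> A B"
    and norm_scale: "\<lbrakk>A \<in> Obj C; B \<in> Obj C; t \<in> Hom C A B\<rbrakk> \<Longrightarrow> Norm C (c \<odot> t) = cmod c * Norm C t"
    and norm_add: "\<lbrakk>A \<in> Obj C; B \<in> Obj C; s \<in> Hom C A B; t \<in> Hom C A B\<rbrakk>
      \<Longrightarrow> Norm C (s \<oplus> t) \<le> Norm C s + Norm C t"
    and complete: "\<lbrakk>A \<in> Obj C; B \<in> Obj C; \<And>n. X n \<in> Hom C A B;
        \<And>e. e > 0 \<Longrightarrow> \<exists>N. \<forall>m\<ge>N. \<forall>n\<ge>N. Norm C (X m \<oplus> (-1) \<odot> X n) < e\<rbrakk>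
      \<Longrightarrow> \<exists>t\<in>Hom C A B. (\<lambda>n. Norm C (X n \<oplus> (-1) \<odot> t)) \<longlonglongrightarrow> 0"
    and norm_comp: "\<lbrakk>A \<in> Obj C; B \<in> Obj C; D \<in> Obj C; t \<in> Hom C A B; s \<in> Hom C B D\<rbrakk>
      \<Longrightarrow> Norm C (s \<cdot> t) \<le> Norm C s * Norm C t"
    and norm_adj_comp: "\<lbrakk>A \<in> Obj C; B \<in> Obj C; t \<in> Hom C A B\<rbrakk> \<Longrightarrow> Norm C (t\<^sup>\<star> \<cdot> t) = (Norm C t)\<^sup>2"
    \<comment> \<open>\<open>t\<^sup>\<star> \<cdot> t\<close> is a positive element of the C*-algebra \<open>(A,A)\<close>\<close>
    and adj_comp_positive: "\<lbrakk>A \<in> Obj C; B \<in> Obj C; t \<in> Hom C A B\<rbrakk>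
      \<Longrightarrow> \<exists>s\<in>Hom C A A. t\<^sup>\<star> \<cdot> t = s\<^sup>\<star> \<cdot> s"

text \<open>
  The Banach dual of \<open>(A,B)\<close>. Functionals are set to \<open>0\<close> outside \<open>Hom C A B\<close>, so that equality of
  functionals is equality of HOL functions.
\<close>

definition dual_space :: "('o, 'a) tensor_category \<Rightarrow> 'o \<Rightarrow> 'o \<Rightarrow> ('a \<Rightarrow> complex) set" where
  "dual_space C A B = {f.
     (\<forall>s\<in>Hom C A B. \<forall>t\<in>Hom C A B. f (s \<oplus>\<^bsub>C\<^esub> t) = f s + f t) \<and>
     (\<forall>c. \<forall>t\<in>Hom C A B. f (c \<odot>\<^bsub>C\<^esub> t) = c * f t) \<and>
     (\<exists>M. \<forall>t\<in>Hom C A B. cmod (f t) \<le> M * Norm C t) \<and>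
     (\<forall>t. t \<notin> Hom C A B \<longrightarrow> f t = 0)}"

definition dual_norm :: "('o, 'a) tensor_category \<Rightarrow> 'o \<Rightarrow> 'o \<Rightarrow> ('a \<Rightarrow> complex) \<Rightarrow> real" where
  "dual_norm C A B f = (SUP t\<in>{t \<in> Hom C A B. Norm C t \<le> 1}. cmod (f t))"

text \<open>
  A Banach space of which \<open>(A,B)\<close> is the dual sits canonically as a norm-closed subspace \<open>P\<close>
  of the dual of \<open>(A,B)\<close>; evaluation then identifies \<open>(A,B)\<close> isometrically with the dual of \<open>P\<close>.
\<close>

definition predual :: "('o, 'a) tensor_category \<Rightarrow> 'o \<Rightarrow> 'o \<Rightarrow> ('a \<Rightarrow> complex) set \<Rightarrow> bool" where
  "predual C A B P \<longleftrightarrow>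
     P \<subseteq> dual_space C A B \<and>
     (\<lambda>_. 0) \<in> P \<and>
     (\<forall>f\<in>P. \<forall>g\<in>P. (\<lambda>t. f t + g t) \<in> P) \<and>
     (\<forall>c. \<forall>f\<in>P. (\<lambda>t. c * f t) \<in> P) \<and>
     (\<forall>F g. (\<forall>n. F n \<in> P) \<and> g \<in> dual_space C A B \<and>
        (\<lambda>n. dual_norm C A B (\<lambda>t. F n t - g t)) \<longlonglongrightarrow> 0 \<longrightarrow> g \<in> P) \<and>
     (\<forall>t\<in>Hom C A B. Norm C t = (SUP f\<in>{f \<in> P. dual_norm C A B f \<le> 1}. cmod (f t))) \<and>
     (\<forall>\<Phi>. (\<forall>f\<in>P. \<forall>g\<in>P. \<Phi> (\<lambda>t. f t + g t) = \<Phi> f + \<Phi> g) \<and>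
          (\<forall>c. \<forall>f\<in>P. \<Phi> (\<lambda>t. c * f t) = c * \<Phi> f) \<and>
          (\<exists>M. \<forall>f\<in>P. cmod (\<Phi> f) \<le> M * dual_norm C A B f)
        \<longrightarrow> (\<exists>t\<in>Hom C A B. \<forall>f\<in>P. \<Phi> f = f t))"

locale Wstar_category = Cstar_category +
  assumes predual_exists: "\<lbrakk>A \<in> Obj C; B \<in> Obj C\<rbrakk> \<Longrightarrow> \<exists>P. predual C A B P"

text \<open>
  Normal (that is, \<open>\<sigma>\<close>-weakly continuous) functionals on \<open>(A,B)\<close>; the values of \<open>f\<close> outside
  \<open>Hom C A B\<close> are irrelevant. Preduals of the hom-spaces of a W*-category are unique.
\<close>

definition normal :: "('o, 'a) tensor_category \<Rightarrow> 'o \<Rightarrow> 'o \<Rightarrow> ('a \<Rightarrow> complex) \<Rightarrow> bool" where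
  "normal C A B f \<longleftrightarrow> (\<exists>P. predual C A B P \<and> (\<lambda>t. if t \<in> Hom C A B then f t else 0) \<in> P)"

locale strict_tensor_Wstar_category = Wstar_category +
  assumes unit_obj: "Unit C \<in> Obj C"
    and tensor_obj: "\<lbrakk>A \<in> Obj C; B \<in> Obj C\<rbrakk> \<Longrightarrow> A \<boxtimes> B \<in> Obj C"
    and tensor_obj_assoc: "\<lbrakk>A \<in> Obj C; B \<in> Obj C; D \<in> Obj C\<rbrakk> \<Longrightarrow> (A \<boxtimes> B) \<boxtimes> D = A \<boxtimes> (B \<boxtimes> D)"
    and unit_tensor_obj: "A \<in> Obj C \<Longrightarrow> Unit C \<boxtimes> A = A"
    and tensor_obj_unit: "A \<in> Obj C \<Longrightarrow> A \<boxtimes> Unit C = A"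
    and tensor_hom: "\<lbrakk>A \<in> Obj C; B \<in> Obj C; A' \<in> Obj C; B' \<in> Obj C; s \<in> Hom C A B; t \<in> Hom C A' B'\<rbrakk>
      \<Longrightarrow> s \<otimes> t \<in> Hom C (A \<boxtimes> A') (B \<boxtimes> B')"
    and tensor_ident: "\<lbrakk>A \<in> Obj C; B \<in> Obj C\<rbrakk> \<Longrightarrow> \<one> A \<otimes> \<one> B = \<one> (A \<boxtimes> B)"
    and tensor_comp: "\<lbrakk>A \<in> Obj C; B \<in> Obj C; D \<in> Obj C; A' \<in> Obj C; B' \<in> Obj C; D' \<in> Obj C;
        s \<in> Hom C A B; r \<in> Hom C B D; s' \<in> Hom C A' B'; r' \<in> Hom C B' D'\<rbrakk>
      \<Longrightarrow> (r \<otimes> r') \<cdot> (s \<otimes> s') = (r \<cdot> s) \<otimes> (r' \<cdot> s')"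
    and tensor_assoc: "\<lbrakk>A \<in> Obj C; B \<in> Obj C; A' \<in> Obj C; B' \<in> Obj C; A'' \<in> Obj C; B'' \<in> Obj C;
        r \<in> Hom C A B; s \<in> Hom C A' B'; t \<in> Hom C A'' B''\<rbrakk> \<Longrightarrow> (r \<otimes> s) \<otimes> t = r \<otimes> (s \<otimes> t)"
    and unit_tensor: "\<lbrakk>A \<in> Obj C; B \<in> Obj C; t \<in> Hom C A B\<rbrakk> \<Longrightarrow> \<one> (Unit C) \<otimes> t = t"
    and tensor_unit: "\<lbrakk>A \<in> Obj C; B \<in> Obj C; t \<in> Hom C A B\<rbrakk> \<Longrightarrow> t \<otimes> \<one> (Unit C) = t"
    and tensor_add_left: "\<lbrakk>A \<in> Obj C; B \<in> Obj C; A' \<in> Obj C; B' \<in> Obj C;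
        r \<in> Hom C A B; s \<in> Hom C A B; t \<in> Hom C A' B'\<rbrakk> \<Longrightarrow> (r \<oplus> s) \<otimes> t = (r \<otimes> t) \<oplus> (s \<otimes> t)"
    and tensor_add_right: "\<lbrakk>A \<in> Obj C; B \<in> Obj C; A' \<in> Obj C; B' \<in> Obj C;
        r \<in> Hom C A B; s \<in> Hom C A' B'; t \<in> Hom C A' B'\<rbrakk> \<Longrightarrow> r \<otimes> (s \<oplus> t) = (r \<otimes> s) \<oplus> (r \<otimes> t)"
    and tensor_scale_left: "\<lbrakk>A \<in> Obj C; B \<in> Obj C; A' \<in> Obj C; B' \<in> Obj C; s \<in> Hom C A B; t \<in> Hom C A' B'\<rbrakk>
      \<Longrightarrow> (c \<odot> s) \<otimes> t = c \<odot> (s \<otimes> t)"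
    and tensor_scale_right: "\<lbrakk>A \<in> Obj C; B \<in> Obj C; A' \<in> Obj C; B' \<in> Obj C; s \<in> Hom C A B; t \<in> Hom C A' B'\<rbrakk>
      \<Longrightarrow> s \<otimes> (c \<odot> t) = c \<odot> (s \<otimes> t)"
    and tensor_adj: "\<lbrakk>A \<in> Obj C; B \<in> Obj C; A' \<in> Obj C; B' \<in> Obj C; s \<in> Hom C A B; t \<in> Hom C A' B'\<rbrakk>
      \<Longrightarrow> (s \<otimes> t)\<^sup>\<star> = s\<^sup>\<star> \<otimes> t\<^sup>\<star>"

definition unitary :: "('o, 'a) tensor_category \<Rightarrow> 'o \<Rightarrow> 'o \<Rightarrow> 'a \<Rightarrow> bool" where
  "unitary C A B u \<longleftrightarrow> u \<in> Hom C A B \<and> u\<^sup>\<star>\<^bsub>C\<^esub> \<cdot>\<^bsub>C\<^esub> u = \<one>\<^bsub>C\<^esub> A \<and> u \<cdot>\<^bsub>C\<^esub> u\<^sup>\<star>\<^bsub>C\<^esub> = \<one>\<^bsub>C\<^esub> B"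


section \<open>Tensor W*-categories of Hilbert spaces\<close>

text \<open>
  \<open>H\<close> is the direct sum of the objects \<open>A i\<close> with embeddings \<open>w i\<close>: the \<open>w i\<close> are isometries with
  orthogonal ranges, and the sum of the projections \<open>w i \<cdot> (w i)\<^sup>\<star>\<close> is \<open>\<sigma>\<close>-weakly convergent to
  \<open>\<one> H\<close>.
\<close>

definition direct_sum :: "('o, 'a) tensor_category \<Rightarrow> 'o \<Rightarrow> 'i set \<Rightarrow> ('i \<Rightarrow> 'o) \<Rightarrow> ('i \<Rightarrow> 'a) \<Rightarrow> bool" where
  "direct_sum C H I A w \<longleftrightarrow>
     (\<forall>i\<in>I. w i \<in> Hom C (A i) H) \<and>
     (\<forall>i\<in>I. (w i)\<^sup>\<star>\<^bsub>C\<^esub> \<cdot>\<^bsub>C\<^esub> w i = \<one>\<^bsub>C\<^esub> (A i)) \<and>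
     (\<forall>i\<in>I. \<forall>j\<in>I. i \<noteq> j \<longrightarrow> (w i)\<^sup>\<star>\<^bsub>C\<^esub> \<cdot>\<^bsub>C\<^esub> w j = \<zero>\<^bsub>C\<^esub> (A j) (A i)) \<and>
     (\<forall>f. normal C H H f \<longrightarrow> ((\<lambda>i. f (w i \<cdot>\<^bsub>C\<^esub> (w i)\<^sup>\<star>\<^bsub>C\<^esub>)) has_sum f (\<one>\<^bsub>C\<^esub> H)) I)"

text \<open>
  Every object is a direct sum of copies of the unit. Since \<open>\<one> (Unit C) \<noteq> \<zero>\<close>, the isometries \<open>w i\<close>
  are pairwise distinct arrows, so index sets in the type of arrows suffice. That the functors
  \<open>X \<times> -\<close> and \<open>- \<times> X\<close> are normal on arrows says that the tensor product is the one of Hilbert spaces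
  also in infinite dimensions: the tensor product of two orthonormal bases is an orthonormal basis.
\<close>

locale Hilbert_tensor_category = strict_tensor_Wstar_category C
  for C :: "('o, 'a) tensor_category" (structure) +
  assumes scalars: "bij_betw (\<lambda>c. c \<odot> \<one> (Unit C)) UNIV (Hom C (Unit C) (Unit C))"
    and sum_of_units: "H \<in> Obj C \<Longrightarrow> \<exists>(I :: 'a set) w. direct_sum C H I (\<lambda>_. Unit C) w"
    and tensor_left_normal: "\<lbrakk>X \<in> Obj C; A \<in> Obj C; B \<in> Obj C; normal C (X \<boxtimes> A) (X \<boxtimes> B) f\<rbrakk>
      \<Longrightarrow> normal C A B (\<lambda>t. f (\<one> X \<otimes> t))"
    and tensor_right_normal: "\<lbrakk>X \<in> Obj C; A \<in> Obj C; B \<in> Obj C; normal C (A \<boxtimes> X) (B \<boxtimes> X) f\<rbrakk>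
      \<Longrightarrow> normal C A B (\<lambda>t. f (t \<otimes> \<one> X))"

text \<open>
  For a category of Hilbert spaces the permutation symmetry is the flip: naturality and
  \<open>\<theta> (Unit C) (Unit C) = \<one> (Unit C)\<close> give \<open>\<theta> A B \<cdot> (\<psi> \<otimes> \<phi>) = \<phi> \<otimes> \<psi>\<close> on vectors
  \<open>\<psi> \<in> Hom C (Unit C) A\<close> and \<open>\<phi> \<in> Hom C (Unit C) B\<close>.
\<close>

definition permutation_symmetry :: "('o, 'a) tensor_category \<Rightarrow> ('o \<Rightarrow> 'o \<Rightarrow> 'a) \<Rightarrow> bool" where
  "permutation_symmetry C \<theta> \<longleftrightarrow>
     (\<forall>A\<in>Obj C. \<forall>B\<in>Obj C.
        unitary C (A \<boxtimes>\<^bsub>C\<^esub> B) (B \<boxtimes>\<^bsub>C\<^esub> A) (\<theta> A B) \<and> \<theta> B A \<cdot>\<^bsub>C\<^esub> \<theta> A B = \<one>\<^bsub>C\<^esub> (A \<boxtimes>\<^bsub>C\<^esub> B)) \<and>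
     (\<forall>A\<in>Obj C. \<forall>B\<in>Obj C. \<forall>A'\<in>Obj C. \<forall>B'\<in>Obj C. \<forall>s\<in>Hom C A A'. \<forall>t\<in>Hom C B B'.
        \<theta> A' B' \<cdot>\<^bsub>C\<^esub> (s \<otimes>\<^bsub>C\<^esub> t) = (t \<otimes>\<^bsub>C\<^esub> s) \<cdot>\<^bsub>C\<^esub> \<theta> A B) \<and>
     (\<forall>A\<in>Obj C. \<forall>B\<in>Obj C. \<forall>D\<in>Obj C.
        \<theta> (A \<boxtimes>\<^bsub>C\<^esub> B) D = (\<theta> A D \<otimes>\<^bsub>C\<^esub> \<one>\<^bsub>C\<^esub> B) \<cdot>\<^bsub>C\<^esub> (\<one>\<^bsub>C\<^esub> A \<otimes>\<^bsub>C\<^esub> \<theta> B D))"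


section \<open>Tensor *-functors, subcategories and isomorphisms\<close>

definition tensor_star_functor ::
  "('o, 'a) tensor_category \<Rightarrow> ('p, 'b) tensor_category \<Rightarrow> ('o \<Rightarrow> 'p) \<Rightarrow> ('a \<Rightarrow> 'b) \<Rightarrow> bool" where
  "tensor_star_functor C D Fo Fa \<longleftrightarrow>
     (\<forall>A\<in>Obj C. Fo A \<in> Obj D \<and> Fa (\<one>\<^bsub>C\<^esub> A) = \<one>\<^bsub>D\<^esub> (Fo A)) \<and>
     (\<forall>A\<in>Obj C. \<forall>B\<in>Obj C. \<forall>t\<in>Hom C A B. Fa t \<in> Hom D (Fo A) (Fo B)) \<and>
     (\<forall>A\<in>Obj C. \<forall>B\<in>Obj C. \<forall>E\<in>Obj C. \<forall>t\<in>Hom C A B. \<forall>s\<in>Hom C B E.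
        Fa (s \<cdot>\<^bsub>C\<^esub> t) = Fa s \<cdot>\<^bsub>D\<^esub> Fa t) \<and>
     (\<forall>A\<in>Obj C. \<forall>B\<in>Obj C. \<forall>s\<in>Hom C A B. \<forall>t\<in>Hom C A B. Fa (s \<oplus>\<^bsub>C\<^esub> t) = Fa s \<oplus>\<^bsub>D\<^esub> Fa t) \<and>
     (\<forall>A\<in>Obj C. \<forall>B\<in>Obj C. \<forall>t\<in>Hom C A B. \<forall>c. Fa (c \<odot>\<^bsub>C\<^esub> t) = c \<odot>\<^bsub>D\<^esub> Fa t) \<and>
     (\<forall>A\<in>Obj C. \<forall>B\<in>Obj C. \<forall>t\<in>Hom C A B. Fa (t\<^sup>\<star>\<^bsub>C\<^esub>) = (Fa t)\<^sup>\<star>\<^bsub>D\<^esub>) \<and>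
     Fo (Unit C) = Unit D \<and>
     (\<forall>A\<in>Obj C. \<forall>B\<in>Obj C. Fo (A \<boxtimes>\<^bsub>C\<^esub> B) = Fo A \<boxtimes>\<^bsub>D\<^esub> Fo B) \<and>
     (\<forall>A\<in>Obj C. \<forall>B\<in>Obj C. \<forall>A'\<in>Obj C. \<forall>B'\<in>Obj C. \<forall>s\<in>Hom C A B. \<forall>t\<in>Hom C A' B'.
        Fa (s \<otimes>\<^bsub>C\<^esub> t) = Fa s \<otimes>\<^bsub>D\<^esub> Fa t)"

definition faithful :: "('o, 'a) tensor_category \<Rightarrow> ('a \<Rightarrow> 'b) \<Rightarrow> bool" where
  "faithful C Fa \<longleftrightarrow> (\<forall>A\<in>Obj C. \<forall>B\<in>Obj C. inj_on Fa (Hom C A B))"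

text \<open>The image of an endofunctor, with the operations of the ambient category.\<close>

definition functor_image ::
  "('o, 'a) tensor_category \<Rightarrow> ('o \<Rightarrow> 'o) \<Rightarrow> ('a \<Rightarrow> 'a) \<Rightarrow> ('o, 'a) tensor_category" where
  "functor_image C Fo Fa = C\<lparr>Obj := Fo ` Obj C,
     Hom := (\<lambda>X Y. {Fa t | t A B. A \<in> Obj C \<and> B \<in> Obj C \<and> Fo A = X \<and> Fo B = Y \<and> t \<in> Hom C A B})\<rparr>"

definition tensor_star_subcategory ::
  "('o, 'a) tensor_category \<Rightarrow> ('o, 'a) tensor_category \<Rightarrow> bool" where
  "tensor_star_subcategory S C \<longleftrightarrow>
     S = C\<lparr>Obj := Obj S, Hom := Hom S\<rparr> \<and>
     Obj S \<subseteq> Obj C \<and>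
     (\<forall>A\<in>Obj S. \<forall>B\<in>Obj S. Hom S A B \<subseteq> Hom C A B) \<and>
     (\<forall>A\<in>Obj S. \<one>\<^bsub>C\<^esub> A \<in> Hom S A A) \<and>
     (\<forall>A\<in>Obj S. \<forall>B\<in>Obj S. \<forall>D\<in>Obj S. \<forall>t\<in>Hom S A B. \<forall>s\<in>Hom S B D. s \<cdot>\<^bsub>C\<^esub> t \<in> Hom S A D) \<and>
     (\<forall>A\<in>Obj S. \<forall>B\<in>Obj S. \<zero>\<^bsub>C\<^esub> A B \<in> Hom S A B) \<and>
     (\<forall>A\<in>Obj S. \<forall>B\<in>Obj S. \<forall>s\<in>Hom S A B. \<forall>t\<in>Hom S A B. s \<oplus>\<^bsub>C\<^esub> t \<in> Hom S A B) \<and>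
     (\<forall>A\<in>Obj S. \<forall>B\<in>Obj S. \<forall>t\<in>Hom S A B. \<forall>c. c \<odot>\<^bsub>C\<^esub> t \<in> Hom S A B) \<and>
     (\<forall>A\<in>Obj S. \<forall>B\<in>Obj S. \<forall>t\<in>Hom S A B. t\<^sup>\<star>\<^bsub>C\<^esub> \<in> Hom S B A) \<and>
     Unit C \<in> Obj S \<and>
     (\<forall>A\<in>Obj S. \<forall>B\<in>Obj S. A \<boxtimes>\<^bsub>C\<^esub> B \<in> Obj S) \<and>
     (\<forall>A\<in>Obj S. \<forall>B\<in>Obj S. \<forall>A'\<in>Obj S. \<forall>B'\<in>Obj S. \<forall>s\<in>Hom S A B. \<forall>t\<in>Hom S A' B'.
        s \<otimes>\<^bsub>C\<^esub> t \<in> Hom S (A \<boxtimes>\<^bsub>C\<^esub> A') (B \<boxtimes>\<^bsub>C\<^esub> B'))"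

text \<open>
  An isomorphism is bijective on objects and on arrows. As for *-isomorphisms of W*-algebras,
  it is automatically isometric and hence a homeomorphism for the \<open>\<sigma>\<close>-weak topologies.
\<close>

definition tensor_star_isomorphic ::
  "('o, 'a) tensor_category \<Rightarrow> ('p, 'b) tensor_category \<Rightarrow> bool" where
  "tensor_star_isomorphic C D \<longleftrightarrow>
     (\<exists>Fo Fa. tensor_star_functor C D Fo Fa \<and> bij_betw Fo (Obj C) (Obj D) \<and>
        (\<forall>A\<in>Obj C. \<forall>B\<in>Obj C. bij_betw Fa (Hom C A B) (Hom D (Fo A) (Fo B))))"


section \<open>Right regular objects\<close>

text \<open>
  \<open>leg13 C \<theta> H H' M K L W\<close> is \<open>W \<in> (H \<times> K, H' \<times> L)\<close> acting on the outer two factors of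
  \<open>H \<times> M \<times> K\<close>, with values in \<open>H' \<times> M \<times> L\<close>.
\<close>

definition leg13 :: "('o, 'a) tensor_category \<Rightarrow> ('o \<Rightarrow> 'o \<Rightarrow> 'a) \<Rightarrow>
    'o \<Rightarrow> 'o \<Rightarrow> 'o \<Rightarrow> 'o \<Rightarrow> 'o \<Rightarrow> 'a \<Rightarrow> 'a" where
  "leg13 C \<theta> H H' M K L W =
     (\<one>\<^bsub>C\<^esub> H' \<otimes>\<^bsub>C\<^esub> \<theta> L M) \<cdot>\<^bsub>C\<^esub> (W \<otimes>\<^bsub>C\<^esub> \<one>\<^bsub>C\<^esub> M) \<cdot>\<^bsub>C\<^esub> (\<one>\<^bsub>C\<^esub> H \<otimes>\<^bsub>C\<^esub> \<theta> M K)"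

text \<open>
  A faithful idempotent tensor *-functor \<open>\<iota> = (io, ia)\<close> onto a tensor W*-category of Hilbert spaces.
  The family \<open>\<theta>\<close> comprises the permutation symmetry of the image of \<open>\<iota>\<close> together with its (unique)
  liftings to pairs of objects of which only one need lie in that image.
\<close>

definition Hilbert_functor ::
  "('o, 'a) tensor_category \<Rightarrow> ('o \<Rightarrow> 'o) \<Rightarrow> ('a \<Rightarrow> 'a) \<Rightarrow> ('o \<Rightarrow> 'o \<Rightarrow> 'a) \<Rightarrow> bool" where
  "Hilbert_functor T io ia \<theta> \<longleftrightarrow>
     tensor_star_functor T T io ia \<and> faithful T ia \<and>
     (\<forall>A\<in>Obj T. io (io A) = io A) \<and>
     (\<forall>A\<in>Obj T. \<forall>B\<in>Obj T. \<forall>t\<in>Hom T A B. ia (ia t) = ia t) \<and>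
     Hilbert_tensor_category (functor_image T io ia) \<and>
     permutation_symmetry (functor_image T io ia) \<theta> \<and>
     (\<forall>A\<in>Obj T. \<forall>B\<in>Obj T.
        \<theta> A (io B) \<in> Hom T (A \<boxtimes>\<^bsub>T\<^esub> io B) (io B \<boxtimes>\<^bsub>T\<^esub> A) \<and> ia (\<theta> A (io B)) = \<theta> (io A) (io B) \<and>
        \<theta> (io A) B \<in> Hom T (io A \<boxtimes>\<^bsub>T\<^esub> B) (B \<boxtimes>\<^bsub>T\<^esub> io A) \<and> ia (\<theta> (io A) B) = \<theta> (io A) (io B))"

definition right_regular_object :: "('o, 'a) tensor_category \<Rightarrow> ('o \<Rightarrow> 'o) \<Rightarrow> ('a \<Rightarrow> 'a) \<Rightarrow>
    ('o \<Rightarrow> 'o \<Rightarrow> 'a) \<Rightarrow> 'o \<Rightarrow> ('o \<Rightarrow> 'a) \<Rightarrow> bool" where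
  "right_regular_object T io ia \<theta> V \<eta> \<longleftrightarrow>
     V \<in> Obj T \<and>
     (\<forall>W\<in>Obj T. unitary T (W \<boxtimes>\<^bsub>T\<^esub> V) (io W \<boxtimes>\<^bsub>T\<^esub> V) (\<eta> W)) \<and>
     (\<forall>W\<in>Obj T. \<forall>W'\<in>Obj T. \<forall>t\<in>Hom T W W'.
        \<eta> W' \<cdot>\<^bsub>T\<^esub> (t \<otimes>\<^bsub>T\<^esub> \<one>\<^bsub>T\<^esub> V) = (ia t \<otimes>\<^bsub>T\<^esub> \<one>\<^bsub>T\<^esub> V) \<cdot>\<^bsub>T\<^esub> \<eta> W) \<and>
     (\<forall>W\<in>Obj T. \<forall>W'\<in>Obj T.
        \<eta> (W \<boxtimes>\<^bsub>T\<^esub> W') = leg13 T \<theta> W (io W) (io W') V V (\<eta> W) \<cdot>\<^bsub>T\<^esub> (\<one>\<^bsub>T\<^esub> W \<otimes>\<^bsub>T\<^esub> \<eta> W'))"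


section \<open>Multiplicative unitaries and their representations\<close>

text \<open>
  Below, \<open>C\<close> is a tensor W*-category whose objects are the Hilbert spaces under consideration and \<open>\<theta>\<close> is its flip.
\<close>

definition multiplicative_unitary ::
  "('o, 'a) tensor_category \<Rightarrow> ('o \<Rightarrow> 'o \<Rightarrow> 'a) \<Rightarrow> 'o \<Rightarrow> 'a \<Rightarrow> bool" where
  "multiplicative_unitary C \<theta> K V \<longleftrightarrow>
     K \<in> Obj C \<and> unitary C (K \<boxtimes>\<^bsub>C\<^esub> K) (K \<boxtimes>\<^bsub>C\<^esub> K) V \<and>
     (V \<otimes>\<^bsub>C\<^esub> \<one>\<^bsub>C\<^esub> K) \<cdot>\<^bsub>C\<^esub> leg13 C \<theta> K K K K K V \<cdot>\<^bsub>C\<^esub> (\<one>\<^bsub>C\<^esub> K \<otimes>\<^bsub>C\<^esub> V)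
       = (\<one>\<^bsub>C\<^esub> K \<otimes>\<^bsub>C\<^esub> V) \<cdot>\<^bsub>C\<^esub> (V \<otimes>\<^bsub>C\<^esub> \<one>\<^bsub>C\<^esub> K)"

definition representation ::
  "('o, 'a) tensor_category \<Rightarrow> ('o \<Rightarrow> 'o \<Rightarrow> 'a) \<Rightarrow> 'o \<Rightarrow> 'a \<Rightarrow> 'o \<Rightarrow> 'a \<Rightarrow> bool" where
  "representation C \<theta> K V H W \<longleftrightarrow>
     H \<in> Obj C \<and> unitary C (H \<boxtimes>\<^bsub>C\<^esub> K) (H \<boxtimes>\<^bsub>C\<^esub> K) W \<and>
     (W \<otimes>\<^bsub>C\<^esub> \<one>\<^bsub>C\<^esub> K) \<cdot>\<^bsub>C\<^esub> leg13 C \<theta> H H K K K W \<cdot>\<^bsub>C\<^esub> (\<one>\<^bsub>C\<^esub> H \<otimes>\<^bsub>C\<^esub> V)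
       = (\<one>\<^bsub>C\<^esub> H \<otimes>\<^bsub>C\<^esub> V) \<cdot>\<^bsub>C\<^esub> (W \<otimes>\<^bsub>C\<^esub> \<one>\<^bsub>C\<^esub> K)"

text \<open>
  The category of representations of \<open>V\<close>; its objects are pairs of a Hilbert space and a
  representation on it, and its unit is the trivial representation on the unit.
\<close>

definition Rep_category :: "('o, 'a) tensor_category \<Rightarrow> ('o \<Rightarrow> 'o \<Rightarrow> 'a) \<Rightarrow> 'o \<Rightarrow> 'a \<Rightarrow>
    ('o \<times> 'a, 'a) tensor_category" where
  "Rep_category C \<theta> K V = \<lparr>
     Obj = {(H, W). representation C \<theta> K V H W},
     Hom = (\<lambda>(H, W) (H', W'). {t \<in> Hom C H H'.
       (t \<otimes>\<^bsub>C\<^esub> \<one>\<^bsub>C\<^esub> K) \<cdot>\<^bsub>C\<^esub> W = W' \<cdot>\<^bsub>C\<^esub> (t \<otimes>\<^bsub>C\<^esub> \<one>\<^bsub>C\<^esub> K)}),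
     Comp = Comp C,
     Ident = (\<lambda>(H, W). \<one>\<^bsub>C\<^esub> H),
     Zero = (\<lambda>(H, W) (H', W'). \<zero>\<^bsub>C\<^esub> H H'),
     Add = Add C,
     Scale = Scale C,
     Adj = Adj C,
     Norm = Norm C,
     Unit = (Unit C, \<one>\<^bsub>C\<^esub> K),
     TensorO = (\<lambda>(H, W) (H', W').
       (H \<boxtimes>\<^bsub>C\<^esub> H', leg13 C \<theta> H H H' K K W \<cdot>\<^bsub>C\<^esub> (\<one>\<^bsub>C\<^esub> H \<otimes>\<^bsub>C\<^esub> W'))),
     TensorA = TensorA C\<rparr>"

end

theory Submission
  imports Defs
begin

text \<open>
  Apply \<open>\<iota>\<close> to the regular object: with \<open>K = \<iota>(V)\<close>, every object \<open>A\<close> yields the unitary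
  \<open>\<iota>(\<eta> A)\<close> on \<open>\<iota>(A) \<times> K\<close>. Since \<open>\<eta>\<close> is natural and is the identity on objects in the image
  of \<open>\<iota>\<close>, its naturality with respect to the arrow \<open>\<eta> A\<close> and its tensor formula give the
  representation equation of \<open>\<iota>(\<eta> A)\<close> for \<open>\<iota>(\<eta> V)\<close>. The case \<open>A = V\<close> says that
  \<open>\<iota>(\<eta> V)\<close> is a multiplicative unitary. The remaining naturality says that \<open>\<iota>(t)\<close> intertwines these
  representations.

  Distinct objects of \<open>T\<close> may have the same image under \<open>A \<mapsto> (\<iota>(A), \<iota>(\<eta> A))\<close>. To obtain an injective
  map on objects, the Hilbert spaces are indexed by the objects of \<open>T\<close>: \<open>\<H>\<close> has the objects of
  \<open>T\<close>, with the arrows from \<open>\<iota>(A)\<close> to \<open>\<iota>(B)\<close> in \<open>\<iota>(T)\<close> as arrows from \<open>A\<close> to \<open>B\<close>.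
\<close>

section \<open>Elementary algebra of zeros, negatives and adjoints in a complex *-category\<close>

context complex_star_category
begin

lemma zero_add: "\<lbrakk>A \<in> Obj C; B \<in> Obj C; t \<in> Hom C A B\<rbrakk> \<Longrightarrow> \<zero> A B \<oplus> t = t"
  using add_zero add_commute zero_hom by metis

lemma add_self_zero:
  assumes "A \<in> Obj C" "B \<in> Obj C" "t \<in> Hom C A B" "t \<oplus> t = t"
  shows "t = \<zero> A B"
  using add_assoc[OF assms(1,2,3,3), of "(-1) \<odot> t"] assms add_inverse add_zero scale_hom by metis

lemma eq_of_diff_zero:
  assumes "A \<in> Obj C" "B \<in> Obj C" "s \<in> Hom C A B" "t \<in> Hom C A B" "s \<oplus> (-1) \<odot> t = \<zero> A B"
  shows "s = t"
proof -
  have m: "(-1) \<odot> t \<in> Hom C A B" using assms scale_hom by blast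
  have "s = s \<oplus> (t \<oplus> (-1) \<odot> t)" using assms add_inverse add_zero by metis
  also have "\<dots> = (s \<oplus> (-1) \<odot> t) \<oplus> t"
    using add_assoc[OF assms(1,2,3) m assms(4)] add_commute[OF assms(1,2,4) m] by simp
  also have "\<dots> = t" using assms zero_add by simp
  finally show ?thesis .
qed

lemma zero_scale:
  assumes "A \<in> Obj C" "B \<in> Obj C" "t \<in> Hom C A B"
  shows "0 \<odot> t = \<zero> A B"
  using scale_add_left[OF assms, of 0 0] add_self_zero scale_hom assms by simp

lemma scale_zero:
  assumes "A \<in> Obj C" "B \<in> Obj C"
  shows "c \<odot> \<zero> A B = \<zero> A B"
  using scale_scale[OF assms zero_hom, of c 0] zero_scale zero_hom assms by simp

lemma zero_comp:
  assumes "A \<in> Obj C" "B \<in> Obj C" "D \<in> Obj C" "t \<in> Hom C A B"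
  shows "\<zero> B D \<cdot> t = \<zero> A D"
  using comp_scale_left[OF assms zero_hom, of 0] zero_scale zero_hom comp_hom assms by simp

lemma comp_zero:
  assumes "A \<in> Obj C" "B \<in> Obj C" "D \<in> Obj C" "t \<in> Hom C B D"
  shows "t \<cdot> \<zero> A B = \<zero> A D"
  using comp_scale_right[OF assms(1-3) zero_hom assms(4), of 0] zero_scale zero_hom comp_hom assms
  by simp

lemma adj_zero:
  assumes "A \<in> Obj C" "B \<in> Obj C"
  shows "(\<zero> A B)\<^sup>\<star> = \<zero> B A"
  using adj_scale[OF assms zero_hom, of 0] zero_scale zero_hom adj_hom assms by simp

lemma adj_ident:
  assumes "A \<in> Obj C"
  shows "(\<one> A)\<^sup>\<star> = \<one> A"
proof -
  note i = ident_hom[OF assms]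
  note h = adj_hom[OF assms assms i]
  have "((\<one> A)\<^sup>\<star> \<cdot> \<one> A)\<^sup>\<star> = (\<one> A)\<^sup>\<star> \<cdot> \<one> A"
    using adj_comp[OF assms assms assms i h] adj_adj[OF assms assms i] by simp
  then show ?thesis
    using ident_right[OF assms assms h] adj_adj[OF assms assms i] by simp
qed

text \<open>Composing with \<open>u\<^sup>\<star>\<close> cancels one factor. Both the flip with the
  unit object and the unitary attached to the unit object turn out to be trivial for this
  reason.\<close>

lemma unitary_idempotent_eq_ident:
  assumes "A \<in> Obj C" "unitary C A A u" "u = u \<cdot> u"
  shows "u = \<one> A"
proof -
  have u: "u \<in> Hom C A A" "u\<^sup>\<star> \<cdot> u = \<one> A" using assms(2) by (auto simp: unitary_def)
  have "u = \<one> A \<cdot> u" using ident_left assms(1) u(1) by simp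
  also have "\<dots> = u\<^sup>\<star> \<cdot> (u \<cdot> u)"
    using comp_assoc[OF assms(1,1,1,1) u(1) u(1) adj_hom[OF assms(1,1) u(1)]] u(2) by simp
  also have "\<dots> = \<one> A" using assms(3) u(2) by simp
  finally show ?thesis .
qed

end

section \<open>Norms, preduals and the separating property of direct sums\<close>

context Cstar_category
begin

text \<open>This is the triangle inequality for \<open>t\<close> and \<open>(-1) \<odot> t\<close>,
  which have the same norm and sum to zero.\<close>

lemma norm_nonneg:
  assumes "A \<in> Obj C" "B \<in> Obj C" "t \<in> Hom C A B"
  shows "Norm C t \<ge> 0"
  using norm_add[OF assms scale_hom[OF assms, of "-1"]]
      add_inverse[OF assms] norm_scale[OF assms, of "-1"]
      norm_eq_zero[OF assms(1,2) zero_hom[OF assms(1,2)]] by simp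

lemma dual_space_bound:
  assumes "A \<in> Obj C" "B \<in> Obj C" "f \<in> dual_space C A B" "t \<in> Hom C A B"
  shows "cmod (f t) \<le> dual_norm C A B f * Norm C t"
proof -
  obtain M where M: "\<And>t. t \<in> Hom C A B \<Longrightarrow> cmod (f t) \<le> M * Norm C t"
    using assms(3) unfolding dual_space_def by blast
  have sc: "f (c \<odot> t) = c * f t" for c using assms by (auto simp: dual_space_def)
  \<comment> \<open>The real supremum is informative only over a bounded set. As \<open>M\<close>
    may be negative, \<open>\<bar>M\<bar>\<close> serves as the bound.\<close>
  have bdd: "bdd_above ((\<lambda>t. cmod (f t)) ` {t \<in> Hom C A B. Norm C t \<le> 1})"
  proof (rule bdd_aboveI2)
    fix t assume t: "t \<in> {t \<in> Hom C A B. Norm C t \<le> 1}"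
    have "cmod (f t) \<le> M * Norm C t" using M t by simp
    also have "\<dots> \<le> \<bar>M\<bar> * Norm C t" using t norm_nonneg[OF assms(1,2)] by (intro mult_right_mono) auto
    also have "\<dots> \<le> \<bar>M\<bar> * 1" using t by (intro mult_left_mono) auto
    finally show "cmod (f t) \<le> \<bar>M\<bar>" by simp
  qed
  show ?thesis
  \<comment> \<open>An arrow of norm zero cannot be normalised; there the estimate by
    \<open>M\<close> already forces \<open>f t = 0\<close>.\<close>
  proof (cases "Norm C t = 0")
    case True
    then show ?thesis using M[OF assms(4)] by simp
  next
    case False
    then have pos: "Norm C t > 0" using norm_nonneg[OF assms(1,2,4)] by simp
    let ?c = "complex_of_real (inverse (Norm C t))"
    have "cmod (f (?c \<odot> t)) \<le> dual_norm C A B f"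
      unfolding dual_norm_def
    proof (rule cSUP_upper[OF _ bdd])
      show "?c \<odot> t \<in> {t \<in> Hom C A B. Norm C t \<le> 1}"
        using pos scale_hom[OF assms(1,2,4)] norm_scale[OF assms(1,2,4)]
        by (simp add: norm_mult norm_divide norm_inverse del: of_real_inverse)
    qed
    then show ?thesis using pos unfolding sc by (simp add: norm_divide norm_mult field_simps)
  qed
qed

end

context Wstar_category
begin

text \<open>The norm is a supremum over the unit ball of the predual, so an estimate for each single
  functional is enough. In this form norm bounds survive weak limits.\<close>

lemma predual_norm_le:
  assumes "A \<in> Obj C" "B \<in> Obj C" "predual C A B P" "t \<in> Hom C A B"
    and "\<And>f. f \<in> P \<Longrightarrow> dual_norm C A B f \<le> 1 \<Longrightarrow> cmod (f t) \<le> c"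
  shows "Norm C t \<le> c"
proof -
  \<comment> \<open>The zero functional makes the unit ball of \<open>P\<close> nonempty, as the
    estimate of the supremum requires; the zero arrow does the same for the inner supremum.\<close>
  have "dual_norm C A B (\<lambda>_. 0) = (SUP t\<in>{t \<in> Hom C A B. Norm C t \<le> 1}. 0)"
    by (simp add: dual_norm_def)
  moreover have "\<zero> A B \<in> {t \<in> Hom C A B. Norm C t \<le> 1}"
    using zero_hom norm_eq_zero[OF assms(1,2) zero_hom] assms(1,2) by simp
  then have "(SUP t\<in>{t \<in> Hom C A B. Norm C t \<le> 1}. 0::real) = 0"
    by (intro cSUP_const) auto
  ultimately have "(\<lambda>_. 0) \<in> {f \<in> P. dual_norm C A B f \<le> 1}"
    using assms(3) by (simp add: predual_def)
  then have "(SUP f\<in>{f \<in> P. dual_norm C A B f \<le> 1}. cmod (f t)) \<le> c"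
    using assms(5) by (intro cSUP_least) auto
  then show ?thesis using assms(3,4) by (simp add: predual_def)
qed

text \<open>Taking adjoints in \<open>p \<cdot> e = \<zero> H H\<close> gives
  \<open>e \<cdot> p = \<zero> H H\<close>, so the cross terms of
  \<open>(e \<oplus> p)\<^sup>\<star> \<cdot> (e \<oplus> p)\<close> vanish, and the C*-identity
  applies.\<close>

lemma norm_add_orthogonal:
  assumes H: "H \<in> Obj C" and e: "e \<in> Hom C H H" "e\<^sup>\<star> = e" "e \<cdot> e = e"
    and p: "p \<in> Hom C H H" "p\<^sup>\<star> = p" and pe: "p \<cdot> e = \<zero> H H"
  shows "Norm C (e \<oplus> p) ^ 2 = Norm C (e \<oplus> p \<cdot> p)"
proof -
  have ep: "e \<cdot> p = \<zero> H H"
    using adj_comp[OF H H H e(1) p(1)] e p pe adj_zero[OF H H] by simp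
  have s: "e \<oplus> p \<in> Hom C H H" using add_hom H e p by blast
  have pp: "p \<cdot> p \<in> Hom C H H" using comp_hom H p by blast
  have "(e \<oplus> p)\<^sup>\<star> \<cdot> (e \<oplus> p) = (e \<oplus> p) \<cdot> (e \<oplus> p)"
    using adj_add[OF H H e(1) p(1)] e p by simp
  also have "\<dots> = e \<oplus> p \<cdot> p"
    using comp_add_left[OF H H H s e(1) p(1)] comp_add_right[OF H H H e(1) p(1) e(1)]
      comp_add_right[OF H H H e(1) p(1) p(1)] e ep pe add_zero[OF H H e(1)] zero_add[OF H H pp]
    by simp
  finally show ?thesis using norm_adj_comp[OF H H s] by simp
qed

lemma norm_projection_le_one:
  assumes H: "H \<in> Obj C" and e: "e \<in> Hom C H H" "e\<^sup>\<star> = e" "e \<cdot> e = e"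
  shows "Norm C e \<le> 1"
proof (rule ccontr)
  assume "\<not> Norm C e \<le> 1"
  moreover have "Norm C e = Norm C e ^ 2" using norm_adj_comp[OF H H e(1)] e by simp
  ultimately show False by (simp add: power2_eq_square)
qed

text \<open>Squaring twice turns the fourth power of the norm into the norm of \<open>e\<close> plus
  the fourth power of \<open>p\<close>, which is at most 2. A single squaring would only give the
  square root of 2, too weak for the contradiction in \<open>direct_sum_separating\<close>.\<close>

lemma norm_projection_add_orthogonal:
  assumes H: "H \<in> Obj C" and e: "e \<in> Hom C H H" "e\<^sup>\<star> = e" "e \<cdot> e = e"
    and p: "p \<in> Hom C H H" "p\<^sup>\<star> = p" "Norm C p = 1" and pe: "p \<cdot> e = \<zero> H H"
  shows "Norm C (e \<oplus> p) \<le> root 4 2"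
proof -
  let ?q = "p \<cdot> p" and ?N = "Norm C (e \<oplus> p)"
  have q: "?q \<in> Hom C H H" "?q\<^sup>\<star> = ?q" "Norm C ?q = 1"
    using comp_hom[OF H H H p(1) p(1)] adj_comp[OF H H H p(1) p(1)] norm_adj_comp[OF H H p(1)] p
    by simp_all
  have qe: "?q \<cdot> e = \<zero> H H"
    using comp_assoc[OF H H H H e(1) p(1) p(1)] pe comp_zero[OF H H H p(1)] by simp
  have r: "?q \<cdot> ?q \<in> Hom C H H" "Norm C (?q \<cdot> ?q) = 1"
    using comp_hom[OF H H H q(1) q(1)] norm_adj_comp[OF H H q(1)] q by simp_all
  have "?N ^ 4 = (?N ^ 2) ^ 2" by simp
  also have "\<dots> = Norm C (e \<oplus> ?q \<cdot> ?q)"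
    unfolding norm_add_orthogonal[OF H e p(1,2) pe] norm_add_orthogonal[OF H e q(1,2) qe] ..
  also have "\<dots> \<le> 2"
    using norm_add[OF H H e(1) r(1)] r(2) norm_projection_le_one[OF H e] by simp
  finally show ?thesis
    using norm_nonneg[OF H H add_hom[OF H H e(1) p(1)]]
    by (metis real_root_le_iff real_root_power_cancel zero_less_numeral)
qed

text \<open>Arrows have only a binary addition, so the partial sum over \<open>F\<close> is built by
  induction and characterised through the values of functionals. That \<open>e\<close> kills the
  remaining \<open>w j\<close> is what makes the next projection orthogonal to
  \<open>e\<close>.\<close>

lemma direct_sum_partial_projection:
  assumes H: "H \<in> Obj C" and A: "\<And>i. i \<in> I \<Longrightarrow> A i \<in> Obj C" and ds: "direct_sum C H I A w"
    and p: "p \<in> Hom C H H" and pw: "\<And>i. i \<in> I \<Longrightarrow> p \<cdot> w i = \<zero> (A i) H"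
    and "finite F" "F \<subseteq> I"
  shows "\<exists>e. e \<in> Hom C H H \<and> e\<^sup>\<star> = e \<and> e \<cdot> e = e \<and> p \<cdot> e = \<zero> H H \<and>
    (\<forall>j\<in>I - F. e \<cdot> w j = \<zero> (A j) H) \<and>
    (\<forall>f\<in>dual_space C H H. f e = (\<Sum>i\<in>F. f (w i \<cdot> (w i)\<^sup>\<star>)))"
  using assms(6,7)
proof (induction F rule: finite_induct)
  case empty
  have "f (\<zero> H H) = 0" if "f \<in> dual_space C H H" for f
    using that zero_scale[OF H H zero_hom[OF H H]] zero_hom[OF H H]
    unfolding dual_space_def by (metis (mono_tags, lifting) mem_Collect_eq mult_zero_left)
  moreover have "w j \<in> Hom C (A j) H" if "j \<in> I" for j using ds that by (auto simp: direct_sum_def)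
  ultimately show ?case
    using zero_hom[OF H H] adj_zero[OF H H] zero_comp[OF H H H zero_hom[OF H H]]
      comp_zero[OF H H H p] zero_comp[OF A H H] by (intro exI[of _ "\<zero> H H"]) auto
next
  case (insert k F)
  then obtain e where e: "e \<in> Hom C H H" "e\<^sup>\<star> = e" "e \<cdot> e = e" "p \<cdot> e = \<zero> H H"
    and ew: "\<And>j. j \<in> I - F \<Longrightarrow> e \<cdot> w j = \<zero> (A j) H"
    and f: "\<And>f. f \<in> dual_space C H H \<Longrightarrow> f e = (\<Sum>i\<in>F. f (w i \<cdot> (w i)\<^sup>\<star>))" by auto
  have w: "\<And>i. i \<in> I \<Longrightarrow> w i \<in> Hom C (A i) H" "\<And>i. i \<in> I \<Longrightarrow> (w i)\<^sup>\<star> \<cdot> w i = \<one> (A i)"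
    and orth: "\<And>i j. i \<in> I \<Longrightarrow> j \<in> I \<Longrightarrow> i \<noteq> j \<Longrightarrow> (w i)\<^sup>\<star> \<cdot> w j = \<zero> (A j) (A i)"
    using ds by (auto simp: direct_sum_def)
  have ws: "(w i)\<^sup>\<star> \<in> Hom C H (A i)" if "i \<in> I" for i using adj_hom[OF A H w(1)] that by simp
  have k: "k \<in> I" "k \<in> I - F" using insert by auto
  note A = A[OF k(1)] and wk = w(1)[OF k(1)] and wks = ws[OF k(1)]
  let ?k = "w k \<cdot> (w k)\<^sup>\<star>"
  have kh: "?k \<in> Hom C H H" using comp_hom[OF H A H wks wk] .
  have kadj: "?k\<^sup>\<star> = ?k" using adj_comp[OF H A H wks wk] adj_adj[OF A H wk] by simp
  have kj: "?k \<cdot> t = w k \<cdot> ((w k)\<^sup>\<star> \<cdot> t)" if "B \<in> Obj C" "t \<in> Hom C B H" for t B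
    using comp_assoc[OF that(1) H A H that(2) wks wk] by simp
  have kk: "?k \<cdot> ?k = ?k"
  proof -
    have "(w k)\<^sup>\<star> \<cdot> ?k = (w k)\<^sup>\<star>"
      using comp_assoc[OF H A H A wks wk wks] w(2)[OF k(1)] ident_left[OF H A wks] by simp
    then show ?thesis using kj[OF H kh] by simp
  qed
  have ek: "e \<cdot> ?k = \<zero> H H"
    using comp_assoc[OF H A H H wks wk e(1)] ew[OF k(2)] zero_comp[OF H A H wks] by simp
  have ke: "?k \<cdot> e = \<zero> H H"
    using adj_comp[OF H H H kh e(1)] e(2) kadj ek adj_zero[OF H H] by simp
  have pk: "p \<cdot> ?k = \<zero> H H"
    using comp_assoc[OF H A H H wks wk p] pw[OF k(1)] zero_comp[OF H A H wks] by simp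
  have s: "e \<oplus> ?k \<in> Hom C H H" using add_hom[OF H H e(1) kh] .
  have z: "\<zero> B D \<oplus> \<zero> B D = \<zero> B D" if "B \<in> Obj C" "D \<in> Obj C" for B D
    using add_zero zero_hom that by simp
  have "(e \<oplus> ?k) \<cdot> (e \<oplus> ?k) = e \<oplus> ?k"
    using comp_add_left[OF H H H s e(1) kh] comp_add_right[OF H H H e(1) kh e(1)]
      comp_add_right[OF H H H e(1) kh kh] e ek ke kk add_zero[OF H H e(1)] zero_add[OF H H kh]
    by simp
  moreover have "p \<cdot> (e \<oplus> ?k) = \<zero> H H"
    using comp_add_right[OF H H H e(1) kh p] e pk z[OF H H] by simp
  moreover have "(e \<oplus> ?k) \<cdot> w j = \<zero> (A j) H" if j: "j \<in> I - insert k F" for j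
  proof -
    note Aj = assms(2)[of j]
    have wj: "A j \<in> Obj C" "w j \<in> Hom C (A j) H" using Aj w(1) j by auto
    have "?k \<cdot> w j = \<zero> (A j) H"
      using kj[OF wj] orth[OF k(1), of j] j comp_zero[OF wj(1) A H wk] by auto
    then show ?thesis
      using comp_add_left[OF wj(1) H H wj(2) e(1) kh] ew[of j] j z[OF wj(1) H] by simp
  qed
  moreover have "f (e \<oplus> ?k) = (\<Sum>i\<in>insert k F. f (w i \<cdot> (w i)\<^sup>\<star>))" if "f \<in> dual_space C H H" for f
    using f[OF that] that e(1) kh insert.hyps by (simp add: dual_space_def)
  ultimately show ?case
    using s adj_add[OF H H e(1) kh] e(2) kadj by (intro exI[of _ "e \<oplus> ?k"]) auto
qed

text \<open>Weakly, \<open>\<one> H \<oplus> p\<close> is the limit of the arrows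
  \<open>e \<oplus> p\<close>, where \<open>e\<close> runs over the partial sums of the projections
  onto the summands. Each of these has norm at most \<open>root 4 2\<close>, and
  \<open>predual_norm_le\<close> carries the bound to the limit.\<close>

lemma norm_ident_add_orthogonal:
  assumes H: "H \<in> Obj C" and A: "\<And>i. i \<in> I \<Longrightarrow> A i \<in> Obj C" and ds: "direct_sum C H I A w"
    and p: "p \<in> Hom C H H" "p\<^sup>\<star> = p" "Norm C p = 1"
    and pw: "\<And>i. i \<in> I \<Longrightarrow> p \<cdot> w i = \<zero> (A i) H"
  shows "Norm C (\<one> H \<oplus> p) \<le> root 4 2"
proof -
  obtain P where P: "predual C H H P" using predual_exists H by blast
  show ?thesis
  proof (rule predual_norm_le[OF H H P add_hom[OF H H ident_hom[OF H] p(1)]])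
    fix f assume f: "f \<in> P" and f1: "dual_norm C H H f \<le> 1"
    have fd: "f \<in> dual_space C H H" using P f by (auto simp: predual_def)
    have add: "f (s \<oplus> t) = f s + f t" if "s \<in> Hom C H H" "t \<in> Hom C H H" for s t
      using fd that by (simp add: dual_space_def)
    \<comment> \<open>The definition of \<open>normal\<close> cuts a functional off outside the
      hom-set; a member of \<open>dual_space\<close> is already zero there.\<close>
    have "(\<lambda>t. if t \<in> Hom C H H then f t else 0) = f"
      using fd by (auto simp: dual_space_def)
    then have "normal C H H f" using P f by (auto simp: normal_def)
    then have "((\<lambda>i. f (w i \<cdot> (w i)\<^sup>\<star>)) has_sum f (\<one> H)) I"
      using ds by (simp add: direct_sum_def)
    then have "((\<lambda>F. (\<Sum>i\<in>F. f (w i \<cdot> (w i)\<^sup>\<star>)) + f p) \<longlongrightarrow> f (\<one> H) + f p) (finite_subsets_at_top I)"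
      unfolding has_sum_def by (intro tendsto_add tendsto_const)
    then have lim: "((\<lambda>F. cmod ((\<Sum>i\<in>F. f (w i \<cdot> (w i)\<^sup>\<star>)) + f p)) \<longlongrightarrow> cmod (f (\<one> H \<oplus> p)))
        (finite_subsets_at_top I)"
      unfolding add[OF ident_hom[OF H] p(1)] by (rule tendsto_norm)
    show "cmod (f (\<one> H \<oplus> p)) \<le> root 4 2"
    proof (rule tendsto_upperbound[OF lim _ finite_subsets_at_top_neq_bot])
      have "cmod ((\<Sum>i\<in>F. f (w i \<cdot> (w i)\<^sup>\<star>)) + f p) \<le> root 4 2" if F: "finite F" "F \<subseteq> I" for F
      proof -
        obtain e where e: "e \<in> Hom C H H" "e\<^sup>\<star> = e" "e \<cdot> e = e" "p \<cdot> e = \<zero> H H"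
          and fe: "f e = (\<Sum>i\<in>F. f (w i \<cdot> (w i)\<^sup>\<star>))"
          using direct_sum_partial_projection[OF H A ds p(1) pw F] fd by blast
        have s: "e \<oplus> p \<in> Hom C H H" using add_hom[OF H H e(1) p(1)] .
        have "cmod (f (e \<oplus> p)) \<le> dual_norm C H H f * Norm C (e \<oplus> p)"
          using dual_space_bound[OF H H fd s] .
        also have "\<dots> \<le> 1 * Norm C (e \<oplus> p)"
          using f1 norm_nonneg[OF H H s] by (intro mult_right_mono)
        also have "\<dots> \<le> root 4 2"
          using norm_projection_add_orthogonal[OF H e(1-3) p e(4)] by simp
        finally show ?thesis using add[OF e(1) p(1)] fe by simp
      qed
      then show "\<forall>\<^sub>F F in finite_subsets_at_top I.
          cmod ((\<Sum>i\<in>F. f (w i \<cdot> (w i)\<^sup>\<star>)) + f p) \<le> root 4 2"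
        by (intro eventually_finite_subsets_at_top_weakI)
    qed
  qed
qed

text \<open>
  The axioms do not say that composition is \<open>\<sigma>\<close>-weakly continuous, so \<open>y \<cdot> -\<close> cannot simply be applied
  to \<open>\<Sum>i. w i \<cdot> (w i)\<^sup>\<star> = \<one> H\<close>. Only lower semicontinuity of the norm is used: if \<open>p = y\<^sup>\<star> \<cdot> y\<close> had
  norm \<open>1\<close>, then \<open>\<one> H \<plusminus> p\<close> would have norm at most \<open>2\<close> to the power \<open>1/4\<close>, which is too small for
  \<open>4p = (\<one> H + p)\<^sup>2 - (\<one> H - p)\<^sup>2\<close>.
\<close>

lemma direct_sum_separating:
  assumes H: "H \<in> Obj C" and A: "\<And>i. i \<in> I \<Longrightarrow> A i \<in> Obj C" and ds: "direct_sum C H I A w"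
    and y: "y \<in> Hom C H H" and yw: "\<And>i. i \<in> I \<Longrightarrow> y \<cdot> w i = \<zero> (A i) H"
  shows "y = \<zero> H H"
proof (rule ccontr)
  assume "y \<noteq> \<zero> H H"
  then have N: "Norm C y > 0"
    using norm_eq_zero[OF H H y] norm_nonneg[OF H H y] by simp
  have w: "\<And>i. i \<in> I \<Longrightarrow> w i \<in> Hom C (A i) H" using ds by (simp add: direct_sum_def)
  have ys: "y\<^sup>\<star> \<in> Hom C H H" using adj_hom[OF H H y] .
  let ?q = "y\<^sup>\<star> \<cdot> y"
  have q: "?q \<in> Hom C H H" using comp_hom[OF H H H y ys] .
  have qadj: "?q\<^sup>\<star> = ?q" using adj_comp[OF H H H y ys] adj_adj[OF H H y] by simp
  have qw: "?q \<cdot> w i = \<zero> (A i) H" if "i \<in> I" for i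
    using comp_assoc[OF A[OF that] H H H w[OF that] y ys] yw[OF that] comp_zero[OF A[OF that] H H ys]
    by simp
  have scaled: "Norm C (\<one> H \<oplus> c \<odot> ?q) \<le> root 4 2"
    if c: "cnj c = c" "cmod c * (Norm C y)\<^sup>2 = 1" for c
  proof (rule norm_ident_add_orthogonal[OF H A ds])
    show "c \<odot> ?q \<in> Hom C H H" using scale_hom[OF H H q] .
    show "(c \<odot> ?q)\<^sup>\<star> = c \<odot> ?q" using adj_scale[OF H H q] qadj c by simp
    show "Norm C (c \<odot> ?q) = 1" using norm_scale[OF H H q] norm_adj_comp[OF H H y] c by simp
    show "(c \<odot> ?q) \<cdot> w i = \<zero> (A i) H" if "i \<in> I" for i
      using comp_scale_left[OF A[OF that] H H w[OF that] q] qw[OF that] scale_zero[OF A[OF that] H]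
      by simp
  qed
  define c where "c = complex_of_real (1 / (Norm C y)\<^sup>2)"
  define p where "p = c \<odot> ?q"
  have c: "cnj c = c" "cmod c * (Norm C y)\<^sup>2 = 1"
    using N by (simp_all add: c_def norm_divide norm_power)
  have p: "p \<in> Hom C H H" using scale_hom[OF H H q] by (simp add: p_def)
  have m: "(-1) \<odot> p \<in> Hom C H H" using scale_hom[OF H H p] .
  have Np: "Norm C p = 1"
    using norm_scale[OF H H q] norm_adj_comp[OF H H y] c by (simp add: p_def)
  have N1: "Norm C (\<one> H \<oplus> p) \<le> root 4 2" using scaled[OF c] by (simp add: p_def)
  have N2: "Norm C (\<one> H \<oplus> (-1) \<odot> p) \<le> root 4 2"
    using scaled[of "-c"] c scale_scale[OF H H q, of "-1" c] by (simp add: p_def)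
  have id: "\<one> H \<in> Hom C H H" using ident_hom[OF H] .
  obtain P where P: "predual C H H P" using predual_exists H by blast
  have "Norm C p \<le> root 4 2 * root 4 2 / 2"
  proof (rule predual_norm_le[OF H H P p])
    fix f assume f: "f \<in> P" and f1: "dual_norm C H H f \<le> 1"
    have fd: "f \<in> dual_space C H H" using P f by (auto simp: predual_def)
    have add: "f (s \<oplus> t) = f s + f t" if "s \<in> Hom C H H" "t \<in> Hom C H H" for s t
      using fd that by (simp add: dual_space_def)
    have sc: "f (c \<odot> t) = c * f t" if "t \<in> Hom C H H" for c t
      using fd that by (simp add: dual_space_def)
    have sq: "f ((\<one> H \<oplus> t) \<cdot> (\<one> H \<oplus> t)) = f (\<one> H) + 2 * f t + f (t \<cdot> t)"
      and bound: "Norm C (\<one> H \<oplus> t) \<le> root 4 2 \<Longrightarrow>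
        cmod (f ((\<one> H \<oplus> t) \<cdot> (\<one> H \<oplus> t))) \<le> root 4 2 * root 4 2"
      if t: "t \<in> Hom C H H" for t
    proof -
      have s: "\<one> H \<oplus> t \<in> Hom C H H" using add_hom[OF H H id t] .
      have ss: "(\<one> H \<oplus> t) \<cdot> (\<one> H \<oplus> t) \<in> Hom C H H" using comp_hom[OF H H H s s] .
      have tt: "t \<cdot> t \<in> Hom C H H" using comp_hom[OF H H H t t] .
      have "(\<one> H \<oplus> t) \<cdot> (\<one> H \<oplus> t) = (\<one> H \<oplus> t) \<oplus> (t \<oplus> t \<cdot> t)"
        using comp_add_left[OF H H H s id t] ident_left[OF H H s]
          comp_add_right[OF H H H id t t] ident_right[OF H H t] by simp
      then show "f ((\<one> H \<oplus> t) \<cdot> (\<one> H \<oplus> t)) = f (\<one> H) + 2 * f t + f (t \<cdot> t)"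
        using add s t tt id add_hom[OF H H t tt] by simp
      assume le: "Norm C (\<one> H \<oplus> t) \<le> root 4 2"
      have "cmod (f ((\<one> H \<oplus> t) \<cdot> (\<one> H \<oplus> t)))
          \<le> dual_norm C H H f * Norm C ((\<one> H \<oplus> t) \<cdot> (\<one> H \<oplus> t))"
        using dual_space_bound[OF H H fd ss] .
      also have "\<dots> \<le> 1 * Norm C ((\<one> H \<oplus> t) \<cdot> (\<one> H \<oplus> t))"
        using f1 norm_nonneg[OF H H ss] by (intro mult_right_mono)
      also have "\<dots> \<le> Norm C (\<one> H \<oplus> t) * Norm C (\<one> H \<oplus> t)"
        using norm_comp[OF H H H s s] by simp
      also have "\<dots> \<le> root 4 2 * root 4 2"
        using le norm_nonneg[OF H H s] by (intro mult_mono) auto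
      finally show "cmod (f ((\<one> H \<oplus> t) \<cdot> (\<one> H \<oplus> t))) \<le> root 4 2 * root 4 2" .
    qed
    have mm: "((-1) \<odot> p) \<cdot> ((-1) \<odot> p) = p \<cdot> p"
      using comp_scale_left[OF H H H m p] comp_scale_right[OF H H H p p]
        scale_scale[OF H H comp_hom[OF H H H p p]] scale_one[OF H H comp_hom[OF H H H p p]] by simp
    have "4 * f p = f ((\<one> H \<oplus> p) \<cdot> (\<one> H \<oplus> p)) - f ((\<one> H \<oplus> (-1) \<odot> p) \<cdot> (\<one> H \<oplus> (-1) \<odot> p))"
      unfolding sq[OF p] sq[OF m] mm sc[OF p] by simp
    then have "cmod (4 * f p) \<le> cmod (f ((\<one> H \<oplus> p) \<cdot> (\<one> H \<oplus> p)))
        + cmod (f ((\<one> H \<oplus> (-1) \<odot> p) \<cdot> (\<one> H \<oplus> (-1) \<odot> p)))"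
      by (simp only: norm_triangle_ineq4)
    also have "\<dots> \<le> root 4 2 * root 4 2 + root 4 2 * root 4 2"
      using bound[OF p N1] bound[OF m N2] by (rule add_mono)
    finally show "cmod (f p) \<le> root 4 2 * root 4 2 / 2" by (simp add: norm_mult)
  qed
  \<comment> \<open>The bound just found for \<open>Norm C p\<close> is half the square root of 2,
    hence below the value 1 recorded in \<open>Np\<close>.\<close>
  moreover have "root 4 2 * root 4 2 < (2::real)"
  proof -
    have "(root 4 2 * root 4 2 :: real) ^ 2 = root 4 2 ^ 4" by (simp only: power2_eq_square power4_eq_xxxx mult.assoc)
    also have "\<dots> = 2" by (rule real_root_pow_pos2) simp_all
    finally have "(root 4 2 * root 4 2 :: real) ^ 2 < 2 ^ 2" by simp
    then show ?thesis by (rule power_less_imp_less_base) simp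
  qed
  ultimately show False using Np by simp
qed

end

section \<open>Transport of a category of Hilbert spaces along a map of objects\<close>

definition pullback_category ::
  "('p, 'a) tensor_category \<Rightarrow> 'o set \<Rightarrow> ('o \<Rightarrow> 'p) \<Rightarrow> 'o \<Rightarrow> ('o \<Rightarrow> 'o \<Rightarrow> 'o) \<Rightarrow>
    ('o, 'a) tensor_category" where
  "pullback_category D Os F u tn = \<lparr>
     Obj = Os,
     Hom = (\<lambda>A B. Hom D (F A) (F B)),
     Comp = Comp D,
     Ident = (\<lambda>A. \<one>\<^bsub>D\<^esub> (F A)),
     Zero = (\<lambda>A B. \<zero>\<^bsub>D\<^esub> (F A) (F B)),
     Add = Add D,
     Scale = Scale D,
     Adj = Adj D,
     Norm = Norm D,
     Unit = u,
     TensorO = tn,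
     TensorA = TensorA D\<rparr>"

lemma pullback_category_simps [simp]:
  fixes D Os F u tn
  defines "P \<equiv> pullback_category D Os F u tn"
  shows "Obj P = Os" "Hom P A B = Hom D (F A) (F B)" "Comp P = Comp D" "Ident P A = Ident D (F A)"
    "Zero P A B = Zero D (F A) (F B)" "Add P = Add D" "Scale P = Scale D" "Adj P = Adj D"
    "Norm P = Norm D" "Unit P = u" "TensorO P = tn" "TensorA P = TensorA D"
  by (simp_all add: P_def pullback_category_def)

lemma predual_pullback [simp]:
  "predual (pullback_category D Os F u tn) A B = predual D (F A) (F B)"
  by (simp add: predual_def dual_space_def dual_norm_def fun_eq_iff)

lemma normal_pullback [simp]:
  "normal (pullback_category D Os F u tn) A B = normal D (F A) (F B)"
  by (simp add: normal_def fun_eq_iff)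

lemma unitary_pullback [simp]:
  "unitary (pullback_category D Os F u tn) A B = unitary D (F A) (F B)"
  by (simp add: unitary_def fun_eq_iff)

text \<open>\<open>F\<close> need not be injective, so the strict laws for \<open>tn\<close> do not
  follow from those in \<open>D\<close> and are imposed on the new objects themselves.\<close>

locale object_pullback =
  fixes D :: "('p, 'a) tensor_category" and Os :: "'o set" and F :: "'o \<Rightarrow> 'p"
    and u :: 'o and tn :: "'o \<Rightarrow> 'o \<Rightarrow> 'o"
  assumes obj: "A \<in> Os \<Longrightarrow> F A \<in> Obj D"
    and unit_mem: "u \<in> Os" and unit_map: "F u = Unit D"
    and tensor_mem: "\<lbrakk>A \<in> Os; B \<in> Os\<rbrakk> \<Longrightarrow> tn A B \<in> Os"
    and tensor_map: "\<lbrakk>A \<in> Os; B \<in> Os\<rbrakk> \<Longrightarrow> F (tn A B) = F A \<boxtimes>\<^bsub>D\<^esub> F B"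
    and assoc: "\<lbrakk>A \<in> Os; B \<in> Os; E \<in> Os\<rbrakk> \<Longrightarrow> tn (tn A B) E = tn A (tn B E)"
    and left_unit: "A \<in> Os \<Longrightarrow> tn u A = A"
    and right_unit: "A \<in> Os \<Longrightarrow> tn A u = A"
begin

abbreviation "P \<equiv> pullback_category D Os F u tn"

text \<open>Arrows and their operations, hence also preduals and normal functionals, are those of
  \<open>D\<close> between images under \<open>F\<close>. Each axiom about arrows is an instance of
  the one for \<open>D\<close>; only the laws for objects come from the locale.\<close>

lemma Hilbert_tensor_category_pullback:
  assumes "Hilbert_tensor_category D"
  shows "Hilbert_tensor_category P"
proof -
  interpret D: Hilbert_tensor_category D by fact
  have 1: "complex_star_category P"
    by (intro complex_star_category.intro; (simp only: pullback_category_simps)?; fact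
      D.ident_hom[OF obj] D.comp_hom[OF obj obj obj] D.comp_assoc[OF obj obj obj obj]
      D.ident_left[OF obj obj] D.ident_right[OF obj obj] D.zero_hom[OF obj obj]
      D.add_hom[OF obj obj] D.scale_hom[OF obj obj] D.add_assoc[OF obj obj]
      D.add_commute[OF obj obj] D.add_zero[OF obj obj] D.add_inverse[OF obj obj]
      D.scale_one[OF obj obj] D.scale_scale[OF obj obj] D.scale_add_right[OF obj obj]
      D.scale_add_left[OF obj obj] D.comp_add_left[OF obj obj obj] D.comp_add_right[OF obj obj obj]
      D.comp_scale_left[OF obj obj obj] D.comp_scale_right[OF obj obj obj] D.adj_hom[OF obj obj]
      D.adj_adj[OF obj obj] D.adj_comp[OF obj obj obj] D.adj_add[OF obj obj]
      D.adj_scale[OF obj obj])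
  have 2: "Cstar_category P"
    by (intro Cstar_category.intro 1 Cstar_category_axioms.intro;
      (simp only: pullback_category_simps)?; fact
      D.norm_eq_zero[OF obj obj] D.norm_scale[OF obj obj] D.norm_add[OF obj obj]
      D.complete[OF obj obj] D.norm_comp[OF obj obj obj] D.norm_adj_comp[OF obj obj]
      D.adj_comp_positive[OF obj obj])
  have 3: "Wstar_category P"
    using 2 D.predual_exists obj by (simp add: Wstar_category_def Wstar_category_axioms_def)
  have 4: "strict_tensor_Wstar_category P"
    by (intro strict_tensor_Wstar_category.intro 3 strict_tensor_Wstar_category_axioms.intro;
      (simp only: pullback_category_simps unit_map tensor_map)?;
      (fact unit_mem tensor_mem assoc left_unit right_unit
      D.tensor_hom[OF obj obj obj obj] D.tensor_ident[OF obj obj] D.tensor_comp[OF obj obj obj obj obj obj]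
      D.tensor_assoc[OF obj obj obj obj obj obj] D.unit_tensor[OF obj obj] D.tensor_unit[OF obj obj]
      D.tensor_add_left[OF obj obj obj obj] D.tensor_add_right[OF obj obj obj obj] D.tensor_scale_left[OF obj obj obj obj]
      D.tensor_scale_right[OF obj obj obj obj] D.tensor_adj[OF obj obj obj obj])?)
  show ?thesis
  proof (intro Hilbert_tensor_category.intro 4 Hilbert_tensor_category_axioms.intro)
    show "bij_betw (\<lambda>c. c \<odot>\<^bsub>P\<^esub> \<one>\<^bsub>P\<^esub> (Unit P)) UNIV (Hom P (Unit P) (Unit P))"
      using D.scalars by (simp add: unit_map)
    show "\<exists>(I :: 'a set) w. direct_sum P H I (\<lambda>_. Unit P) w" if "H \<in> Obj P" for H
      using D.sum_of_units[OF obj] that by (simp add: direct_sum_def unit_map)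
    show "normal P A B (\<lambda>t. f (\<one>\<^bsub>P\<^esub> X \<otimes>\<^bsub>P\<^esub> t))"
      if "X \<in> Obj P" "A \<in> Obj P" "B \<in> Obj P" "normal P (X \<boxtimes>\<^bsub>P\<^esub> A) (X \<boxtimes>\<^bsub>P\<^esub> B) f" for X A B f
      using D.tensor_left_normal[OF obj obj obj] that by (simp add: tensor_map)
    show "normal P A B (\<lambda>t. f (t \<otimes>\<^bsub>P\<^esub> \<one>\<^bsub>P\<^esub> X))"
      if "X \<in> Obj P" "A \<in> Obj P" "B \<in> Obj P" "normal P (A \<boxtimes>\<^bsub>P\<^esub> X) (B \<boxtimes>\<^bsub>P\<^esub> X) f" for X A B f
      using D.tensor_right_normal[OF obj obj obj] that by (simp add: tensor_map)
  qed
qed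

lemma permutation_symmetry_pullback:
  assumes "permutation_symmetry D \<theta>"
  shows "permutation_symmetry P (\<lambda>A B. \<theta> (F A) (F B))"
  using assms obj unfolding permutation_symmetry_def
  by (simp add: tensor_map)

end

section \<open>Flips with the unit, legs of identities and tensor products of direct sums\<close>

context strict_tensor_Wstar_category
begin

text \<open>The hexagon identity for \<open>Unit C\<close>, \<open>Unit C\<close>, \<open>A\<close>
  makes the unitary \<open>\<theta> (Unit C) A\<close> idempotent, hence an identity. The other flip
  is its inverse.\<close>

lemma symmetry_unit:
  assumes "permutation_symmetry C \<theta>" "A \<in> Obj C"
  shows "\<theta> (Unit C) A = \<one> A" "\<theta> A (Unit C) = \<one> A"
proof -
  have u: "unitary C A A (\<theta> (Unit C) A)" "\<theta> A (Unit C) \<in> Hom C A A"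
    and inv: "\<theta> A (Unit C) \<cdot> \<theta> (Unit C) A = \<one> A"
    and hex: "\<theta> (Unit C \<boxtimes> Unit C) A
      = (\<theta> (Unit C) A \<otimes> \<one> (Unit C)) \<cdot> (\<one> (Unit C) \<otimes> \<theta> (Unit C) A)"
    using assms unit_obj tensor_obj_unit unit_tensor_obj
    unfolding permutation_symmetry_def unitary_def by metis+
  have m: "\<theta> (Unit C) A \<in> Hom C A A" using u by (simp add: unitary_def)
  have "\<theta> (Unit C) A = \<theta> (Unit C) A \<cdot> \<theta> (Unit C) A"
    using hex unit_tensor_obj[OF unit_obj] tensor_unit[OF assms(2,2) m] unit_tensor[OF assms(2,2) m]
    by simp
  then show 1: "\<theta> (Unit C) A = \<one> A"
    using unitary_idempotent_eq_ident assms(2) u(1) by blast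
  show "\<theta> A (Unit C) = \<one> A"
    using inv ident_right[OF assms(2,2) u(2)] unfolding 1 by simp
qed

lemma leg13_unit:
  assumes "permutation_symmetry C \<theta>" "K \<in> Obj C" "W \<in> Hom C K K"
  shows "leg13 C \<theta> (Unit C) (Unit C) (Unit C) K K W = W"
  using symmetry_unit[OF assms(1,2)] unit_tensor[OF assms(2,2) ident_hom[OF assms(2)]]
    tensor_unit[OF assms(2,2,3)] ident_left[OF assms(2,2,3)] ident_right[OF assms(2,2,3)]
  by (simp add: leg13_def)

text \<open>The middle factor of the leg is an identity, so the two flips meet and cancel.\<close>

lemma leg13_ident:
  assumes "permutation_symmetry C \<theta>" "H \<in> Obj C" "M \<in> Obj C" "K \<in> Obj C"
  shows "leg13 C \<theta> H H M K K (\<one> (H \<boxtimes> K)) = \<one> (H \<boxtimes> M \<boxtimes> K)"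
proof -
  have \<theta>: "\<theta> K M \<in> Hom C (K \<boxtimes> M) (M \<boxtimes> K)" "\<theta> M K \<in> Hom C (M \<boxtimes> K) (K \<boxtimes> M)"
    "\<theta> K M \<cdot> \<theta> M K = \<one> (M \<boxtimes> K)"
    using assms unfolding permutation_symmetry_def unitary_def by blast+
  note ob = assms(2-4) tensor_obj[OF assms(3,4)] tensor_obj[OF assms(4,3)]
  have "\<one> H \<otimes> \<theta> K M \<in> Hom C (H \<boxtimes> K \<boxtimes> M) (H \<boxtimes> (M \<boxtimes> K))"
    using tensor_hom[OF ob(1,1,5,4) ident_hom[OF ob(1)] \<theta>(1)] tensor_obj_assoc ob by simp
  then have "(\<one> H \<otimes> \<theta> K M) \<cdot> (\<one> (H \<boxtimes> K) \<otimes> \<one> M) = \<one> H \<otimes> \<theta> K M"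
    using ident_right tensor_ident tensor_obj ob by metis
  then have "leg13 C \<theta> H H M K K (\<one> (H \<boxtimes> K)) = (\<one> H \<otimes> \<theta> K M) \<cdot> (\<one> H \<otimes> \<theta> M K)"
    by (simp add: leg13_def)
  also have "\<dots> = \<one> H \<otimes> \<one> (M \<boxtimes> K)"
    using tensor_comp[OF ob(1,1,1,4,5,4) ident_hom[OF ob(1)] ident_hom[OF ob(1)] \<theta>(2,1)] \<theta>(3)
      ident_left[OF ob(1,1) ident_hom[OF ob(1)]] by simp
  also have "\<dots> = \<one> (H \<boxtimes> M \<boxtimes> K)" using tensor_ident tensor_obj_assoc ob by simp
  finally show ?thesis .
qed

lemma zero_tensor:
  assumes "A \<in> Obj C" "B \<in> Obj C" "A' \<in> Obj C" "B' \<in> Obj C" "t \<in> Hom C A' B'"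
  shows "\<zero> A B \<otimes> t = \<zero> (A \<boxtimes> A') (B \<boxtimes> B')"
  using tensor_scale_left[OF assms(1-4) zero_hom[OF assms(1,2)] assms(5), of 0] zero_scale zero_hom
    tensor_hom tensor_obj assms by metis

end

text \<open>The relations between the isometries are functoriality of the tensor product.
  Convergence needs normality of tensoring with \<open>X\<close>, which pulls a normal functional
  for \<open>H \<boxtimes> X\<close> back to one for \<open>H\<close>.\<close>

lemma (in Hilbert_tensor_category) direct_sum_tensor:
  assumes H: "H \<in> Obj C" and X: "X \<in> Obj C" and A: "\<And>i. i \<in> I \<Longrightarrow> A i \<in> Obj C"
    and ds: "direct_sum C H I A w"
  shows "direct_sum C (H \<boxtimes> X) I (\<lambda>i. A i \<boxtimes> X) (\<lambda>i. w i \<otimes> \<one> X)"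
  unfolding direct_sum_def
proof (intro conjI ballI impI allI)
  note iX = ident_hom[OF X]
  have XX: "(\<one> X)\<^sup>\<star> \<cdot> \<one> X = \<one> X" "\<one> X \<cdot> (\<one> X)\<^sup>\<star> = \<one> X"
    using adj_ident[OF X] ident_left[OF X X iX] by simp_all
  have w: "w i \<in> Hom C (A i) H" "(w i)\<^sup>\<star> \<in> Hom C H (A i)" if "i \<in> I" for i
    using ds that adj_hom[OF A H] by (simp_all add: direct_sum_def)
  have adj: "(w i \<otimes> \<one> X)\<^sup>\<star> = (w i)\<^sup>\<star> \<otimes> (\<one> X)\<^sup>\<star>" if "i \<in> I" for i
    using tensor_adj[OF A[OF that] H X X w(1)[OF that] iX] .
  have prod: "(w i \<otimes> \<one> X)\<^sup>\<star> \<cdot> (w j \<otimes> \<one> X) = ((w i)\<^sup>\<star> \<cdot> w j) \<otimes> \<one> X"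
    if "i \<in> I" "j \<in> I" for i j
    using tensor_comp[OF A[OF that(2)] H A[OF that(1)] X X X w(1)[OF that(2)] w(2)[OF that(1)] iX
        adj_hom[OF X X iX]] adj[OF that(1)] XX by simp
  show "w i \<otimes> \<one> X \<in> Hom C (A i \<boxtimes> X) (H \<boxtimes> X)" if "i \<in> I" for i
    using tensor_hom[OF A[OF that] H X X w(1)[OF that] iX] .
  show "(w i \<otimes> \<one> X)\<^sup>\<star> \<cdot> (w i \<otimes> \<one> X) = \<one> (A i \<boxtimes> X)" if "i \<in> I" for i
    using prod[OF that that] ds that tensor_ident[OF A[OF that] X] by (simp add: direct_sum_def)
  show "(w i \<otimes> \<one> X)\<^sup>\<star> \<cdot> (w j \<otimes> \<one> X) = \<zero> (A j \<boxtimes> X) (A i \<boxtimes> X)"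
    if "i \<in> I" "j \<in> I" "i \<noteq> j" for i j
    using prod[OF that(1,2)] ds that zero_tensor[OF A[OF that(2)] A[OF that(1)] X X iX]
    by (simp add: direct_sum_def)
  fix f assume "normal C (H \<boxtimes> X) (H \<boxtimes> X) f"
  then have "normal C H H (\<lambda>t. f (t \<otimes> \<one> X))" by (rule tensor_right_normal[OF X H H])
  then have "((\<lambda>i. f ((w i \<cdot> (w i)\<^sup>\<star>) \<otimes> \<one> X)) has_sum f (\<one> H \<otimes> \<one> X)) I"
    using ds unfolding direct_sum_def by blast
  moreover have "(w i \<otimes> \<one> X) \<cdot> (w i \<otimes> \<one> X)\<^sup>\<star> = (w i \<cdot> (w i)\<^sup>\<star>) \<otimes> \<one> X" if "i \<in> I" for i
    using tensor_comp[OF H A[OF that] H X X X w(2)[OF that] w(1)[OF that] adj_hom[OF X X iX] iX]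
      adj[OF that] XX by simp
  ultimately show "((\<lambda>i. f ((w i \<otimes> \<one> X) \<cdot> (w i \<otimes> \<one> X)\<^sup>\<star>)) has_sum f (\<one> (H \<boxtimes> X))) I"
    unfolding tensor_ident[OF H X] by (simp cong: has_sum_cong)
qed

section \<open>The Hilbert space operators obtained from a right regular object\<close>

locale regular_fibre_functor = T: strict_tensor_Wstar_category T
  for T :: "('o, 'a) tensor_category" (structure) +
  fixes io :: "'o \<Rightarrow> 'o" and ia :: "'a \<Rightarrow> 'a" and \<theta> :: "'o \<Rightarrow> 'o \<Rightarrow> 'a" and V :: 'o and \<eta> :: "'o \<Rightarrow> 'a"
  assumes Hilbert: "Hilbert_functor T io ia \<theta>"
    and regular: "right_regular_object T io ia \<theta> V \<eta>"
begin

abbreviation "D \<equiv> functor_image T io ia"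

lemma image_simps [simp]:
  "Obj D = io ` Obj T" "Comp D = Comp T" "Ident D = Ident T"
    "Zero D = Zero T" "Add D = Add T" "Scale D = Scale T" "Adj D = Adj T"
    "Norm D = Norm T" "Unit D = Unit T" "TensorO D = TensorO T" "TensorA D = TensorA T"
  by (simp_all add: functor_image_def)

lemma
  shows io_obj: "A \<in> Obj T \<Longrightarrow> io A \<in> Obj T"
    and ia_ident: "A \<in> Obj T \<Longrightarrow> ia (\<one> A) = \<one> (io A)"
    and ia_hom: "\<lbrakk>A \<in> Obj T; B \<in> Obj T; t \<in> Hom T A B\<rbrakk> \<Longrightarrow> ia t \<in> Hom T (io A) (io B)"
    and ia_comp: "\<lbrakk>A \<in> Obj T; B \<in> Obj T; E \<in> Obj T; t \<in> Hom T A B; s \<in> Hom T B E\<rbrakk>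
      \<Longrightarrow> ia (s \<cdot> t) = ia s \<cdot> ia t"
    and ia_add: "\<lbrakk>A \<in> Obj T; B \<in> Obj T; s \<in> Hom T A B; t \<in> Hom T A B\<rbrakk>
      \<Longrightarrow> ia (s \<oplus> t) = ia s \<oplus> ia t"
    and ia_scale: "\<lbrakk>A \<in> Obj T; B \<in> Obj T; t \<in> Hom T A B\<rbrakk> \<Longrightarrow> ia (c \<odot> t) = c \<odot> ia t"
    and ia_adj: "\<lbrakk>A \<in> Obj T; B \<in> Obj T; t \<in> Hom T A B\<rbrakk> \<Longrightarrow> ia (t\<^sup>\<star>) = (ia t)\<^sup>\<star>"
    and io_unit: "io (Unit T) = Unit T"
    and io_tensor: "\<lbrakk>A \<in> Obj T; B \<in> Obj T\<rbrakk> \<Longrightarrow> io (A \<boxtimes> B) = io A \<boxtimes> io B"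
    and ia_tensor: "\<lbrakk>A \<in> Obj T; B \<in> Obj T; A' \<in> Obj T; B' \<in> Obj T; s \<in> Hom T A B; t \<in> Hom T A' B'\<rbrakk>
      \<Longrightarrow> ia (s \<otimes> t) = ia s \<otimes> ia t"
    and ia_inj: "\<lbrakk>A \<in> Obj T; B \<in> Obj T\<rbrakk> \<Longrightarrow> inj_on ia (Hom T A B)"
    and io_io: "A \<in> Obj T \<Longrightarrow> io (io A) = io A"
    and ia_ia: "\<lbrakk>A \<in> Obj T; B \<in> Obj T; t \<in> Hom T A B\<rbrakk> \<Longrightarrow> ia (ia t) = ia t"
    and image_Hilbert: "Hilbert_tensor_category D"
    and image_symmetry: "permutation_symmetry D \<theta>"
    and symmetry_right: "\<lbrakk>A \<in> Obj T; B \<in> Obj T\<rbrakk> \<Longrightarrow>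
      \<theta> A (io B) \<in> Hom T (A \<boxtimes> io B) (io B \<boxtimes> A) \<and> ia (\<theta> A (io B)) = \<theta> (io A) (io B)"
    and symmetry_left: "\<lbrakk>A \<in> Obj T; B \<in> Obj T\<rbrakk> \<Longrightarrow>
      \<theta> (io A) B \<in> Hom T (io A \<boxtimes> B) (B \<boxtimes> io A) \<and> ia (\<theta> (io A) B) = \<theta> (io A) (io B)"
  using Hilbert unfolding Hilbert_functor_def tensor_star_functor_def faithful_def by meson+

lemma
  shows V_obj: "V \<in> Obj T"
    and eta_unitary: "A \<in> Obj T \<Longrightarrow> unitary T (A \<boxtimes> V) (io A \<boxtimes> V) (\<eta> A)"
    and eta_natural: "\<lbrakk>A \<in> Obj T; B \<in> Obj T; t \<in> Hom T A B\<rbrakk>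
      \<Longrightarrow> \<eta> B \<cdot> (t \<otimes> \<one> V) = (ia t \<otimes> \<one> V) \<cdot> \<eta> A"
    and eta_tensor: "\<lbrakk>A \<in> Obj T; B \<in> Obj T\<rbrakk>
      \<Longrightarrow> \<eta> (A \<boxtimes> B) = leg13 T \<theta> A (io A) (io B) V V (\<eta> A) \<cdot> (\<one> A \<otimes> \<eta> B)"
  using regular unfolding right_regular_object_def by blast+

lemma eta_hom: "A \<in> Obj T \<Longrightarrow> \<eta> A \<in> Hom T (A \<boxtimes> V) (io A \<boxtimes> V)"
  using eta_unitary by (simp add: unitary_def)

lemma image_hom: "\<lbrakk>A \<in> Obj T; B \<in> Obj T; t \<in> Hom T A B\<rbrakk> \<Longrightarrow> ia t \<in> Hom D (io A) (io B)"
  by (auto simp: functor_image_def)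

text \<open>By idempotence \<open>ia\<close> fixes its own values, so naturality of
  \<open>\<eta>\<close> along such an arrow involves the same arrow on both sides.\<close>

lemma image_hom_fixed: "t \<in> Hom D X Y \<Longrightarrow> t \<in> Hom T X Y \<and> ia t = t"
  using ia_hom ia_ia by (auto simp: functor_image_def)

lemma ia_zero:
  assumes "A \<in> Obj T" "B \<in> Obj T"
  shows "ia (\<zero> A B) = \<zero> (io A) (io B)"
  using ia_scale[OF assms T.zero_hom[OF assms], of 0] T.zero_scale[OF assms T.zero_hom[OF assms]]
    T.zero_scale[OF io_obj io_obj ia_hom] T.zero_hom[OF assms] assms by simp

sublocale D: Hilbert_tensor_category D
  by (rule image_Hilbert)

text \<open>From here on \<open>P\<close> is the category \<open>\<H>\<close> of Hilbert spaces
  \<open>io A\<close> indexed by the objects \<open>A\<close> of \<open>T\<close>.\<close>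

sublocale object_pullback D "Obj T" io "Unit T" "TensorO T"
  using T.unit_obj T.tensor_obj io_unit io_tensor T.tensor_obj_assoc T.unit_tensor_obj T.tensor_obj_unit
  by unfold_locales simp_all

sublocale P: Hilbert_tensor_category P
  by (rule Hilbert_tensor_category_pullback[OF image_Hilbert])

abbreviation "flip A B \<equiv> \<theta> (io A) (io B)"

lemma flip_symmetry: "permutation_symmetry P flip"
  by (rule permutation_symmetry_pullback[OF image_symmetry])

abbreviation "R A \<equiv> ia (\<eta> A)"

text \<open>By idempotence of \<open>io\<close>, the source and target of \<open>\<eta> A\<close>
  carry the same Hilbert space, so the image of \<open>\<eta> A\<close> is an endomorphism.\<close>

lemma R_unitary:
  assumes A: "A \<in> Obj T"
  shows "unitary P (A \<boxtimes> V) (A \<boxtimes> V) (R A)"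
proof -
  note ob = T.tensor_obj[OF A V_obj] T.tensor_obj[OF io_obj[OF A] V_obj]
  have io: "io (io A \<boxtimes> V) = io (A \<boxtimes> V)" using A io_tensor V_obj io_obj io_io by simp
  have \<eta>: "\<eta> A \<in> Hom T (A \<boxtimes> V) (io A \<boxtimes> V)" "(\<eta> A)\<^sup>\<star> \<in> Hom T (io A \<boxtimes> V) (A \<boxtimes> V)"
    "(\<eta> A)\<^sup>\<star> \<cdot> \<eta> A = \<one> (A \<boxtimes> V)" "\<eta> A \<cdot> (\<eta> A)\<^sup>\<star> = \<one> (io A \<boxtimes> V)"
    using eta_unitary[OF A] T.adj_hom[OF ob] by (auto simp: unitary_def)
  have "(R A)\<^sup>\<star> \<cdot> R A = \<one> (io (A \<boxtimes> V))" "R A \<cdot> (R A)\<^sup>\<star> = \<one> (io (A \<boxtimes> V))"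
    using ia_comp[OF ob(1,2,1) \<eta>(1,2)] ia_comp[OF ob(2,1,2) \<eta>(2,1)] ia_adj[OF ob \<eta>(1)] \<eta>(3,4)
      ia_ident[OF ob(1)] ia_ident[OF ob(2)] io by simp_all
  then show ?thesis using image_hom[OF ob \<eta>(1)] io by (simp add: unitary_def)
qed

lemma R_hom: "A \<in> Obj T \<Longrightarrow> R A \<in> Hom P (A \<boxtimes> V) (A \<boxtimes> V)"
  using R_unitary unfolding unitary_def by blast

text \<open>Apply \<open>ia\<close> to the naturality square; since \<open>ia (ia t) = ia t\<close>,
  one operator appears on both sides. For general \<open>t\<close> this is the intertwining
  property, and \<open>t = \<eta> A\<close> will give the pentagon equation.\<close>

lemma R_natural:
  assumes A: "A \<in> Obj T" and B: "B \<in> Obj T" and t: "t \<in> Hom T A B"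
  shows "R B \<cdot> (ia t \<otimes> \<one> (io V)) = (ia t \<otimes> \<one> (io V)) \<cdot> R A"
proof -
  note ob = T.tensor_obj[OF A V_obj] T.tensor_obj[OF B V_obj]
    T.tensor_obj[OF io_obj[OF A] V_obj] T.tensor_obj[OF io_obj[OF B] V_obj]
  note iV = T.ident_hom[OF V_obj]
  have tV: "t \<otimes> \<one> V \<in> Hom T (A \<boxtimes> V) (B \<boxtimes> V)" "ia t \<otimes> \<one> V \<in> Hom T (io A \<boxtimes> V) (io B \<boxtimes> V)"
    using T.tensor_hom[OF A B V_obj V_obj t iV]
      T.tensor_hom[OF io_obj[OF A] io_obj[OF B] V_obj V_obj ia_hom[OF A B t] iV] .
  have "ia (t \<otimes> \<one> V) = ia t \<otimes> \<one> (io V)" "ia (ia t \<otimes> \<one> V) = ia t \<otimes> \<one> (io V)"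
    using ia_tensor[OF A B V_obj V_obj t iV] ia_ident[OF V_obj] ia_ia[OF A B t]
      ia_tensor[OF io_obj[OF A] io_obj[OF B] V_obj V_obj ia_hom[OF A B t] iV] by simp_all
  then show ?thesis
    using ia_comp[OF ob(1,2,4) tV(1) eta_hom[OF B]] ia_comp[OF ob(1,3,4) eta_hom[OF A] tV(2)]
      eta_natural[OF A B t] by simp
qed

text \<open>Apply \<open>ia\<close> to each factor of the tensor formula for \<open>\<eta>\<close>.
  The lifted flips between \<open>V\<close> and \<open>io B\<close> become flips of Hilbert
  spaces.\<close>

lemma R_tensor:
  assumes A: "A \<in> Obj T" and B: "B \<in> Obj T"
  shows "R (A \<boxtimes> B) = leg13 P flip A A B V V (R A) \<cdot> (\<one> (io A) \<otimes> R B)"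
proof -
  note V = V_obj and iA = io_obj[OF A] and iB = io_obj[OF B]
  note ob = T.tensor_obj[OF V iB] T.tensor_obj[OF iB V] T.tensor_obj[OF A V] T.tensor_obj[OF iA V]
    T.tensor_obj[OF B V]
  note o3 = T.tensor_obj[OF A ob(5)] T.tensor_obj[OF A ob(2)] T.tensor_obj[OF A ob(1)]
    T.tensor_obj[OF iA ob(1)] T.tensor_obj[OF iA ob(2)]
  note \<theta> = symmetry_right[OF V B] symmetry_left[OF B V]
  have a: "\<one> A \<otimes> \<eta> B \<in> Hom T (A \<boxtimes> (B \<boxtimes> V)) (A \<boxtimes> (io B \<boxtimes> V))"
    using T.tensor_hom[OF A A ob(5,2) T.ident_hom[OF A] eta_hom[OF B]] .
  have b: "\<one> A \<otimes> \<theta> (io B) V \<in> Hom T (A \<boxtimes> (io B \<boxtimes> V)) (A \<boxtimes> (V \<boxtimes> io B))"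
    using T.tensor_hom[OF A A ob(2,1) T.ident_hom[OF A]] \<theta> by simp
  have c: "\<eta> A \<otimes> \<one> (io B) \<in> Hom T (A \<boxtimes> (V \<boxtimes> io B)) (io A \<boxtimes> (V \<boxtimes> io B))"
    using T.tensor_hom[OF ob(3,4) iB iB eta_hom[OF A] T.ident_hom[OF iB]]
      T.tensor_obj_assoc[OF A V iB] T.tensor_obj_assoc[OF iA V iB] by simp
  have d: "\<one> (io A) \<otimes> \<theta> V (io B) \<in> Hom T (io A \<boxtimes> (V \<boxtimes> io B)) (io A \<boxtimes> (io B \<boxtimes> V))"
    using T.tensor_hom[OF iA iA ob(1,2) T.ident_hom[OF iA]] \<theta> by simp
  note dc = T.comp_hom[OF o3(3,4,5) c d]
  note dcb = T.comp_hom[OF o3(2,3,5) b dc]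
  have "R (A \<boxtimes> B)
      = ia (\<one> (io A) \<otimes> \<theta> V (io B)) \<cdot> ia (\<eta> A \<otimes> \<one> (io B)) \<cdot> ia (\<one> A \<otimes> \<theta> (io B) V)
        \<cdot> ia (\<one> A \<otimes> \<eta> B)"
    unfolding eta_tensor[OF A B] leg13_def
    by (simp only: ia_comp[OF o3(1,2,5) a dcb] ia_comp[OF o3(2,3,5) b dc] ia_comp[OF o3(3,4,5) c d])
  also have "ia (\<one> (io A) \<otimes> \<theta> V (io B)) = \<one> (io A) \<otimes> \<theta> (io V) (io B)"
    using ia_tensor[OF iA iA ob(1,2) T.ident_hom[OF iA]] \<theta> ia_ident[OF iA] io_io[OF A] by simp
  also have "ia (\<eta> A \<otimes> \<one> (io B)) = R A \<otimes> \<one> (io B)"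
    using ia_tensor[OF ob(3,4) iB iB eta_hom[OF A] T.ident_hom[OF iB]] ia_ident[OF iB] io_io[OF B]
    by simp
  also have "ia (\<one> A \<otimes> \<theta> (io B) V) = \<one> (io A) \<otimes> \<theta> (io B) (io V)"
    using ia_tensor[OF A A ob(2,1) T.ident_hom[OF A]] \<theta> ia_ident[OF A] by simp
  also have "ia (\<one> A \<otimes> \<eta> B) = \<one> (io A) \<otimes> R B"
    using ia_tensor[OF A A ob(5,2) T.ident_hom[OF A] eta_hom[OF B]] ia_ident[OF A] by simp
  finally show ?thesis by (simp add: leg13_def)
qed

text \<open>A leg across the unit object changes nothing, so the tensor formula for two unit objects
  makes this unitary idempotent.\<close>

lemma R_unit: "R (Unit T) = \<one> (io V)"
proof -
  have V: "V \<in> Obj P" using V_obj by simp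
  have u: "unitary P V V (R (Unit T))"
    using R_unitary[OF T.unit_obj] T.unit_tensor_obj[OF V_obj] by simp
  then have h: "R (Unit T) \<in> Hom P V V" by (simp add: unitary_def)
  have "R (Unit T) = R (Unit T) \<cdot> R (Unit T)"
    using R_tensor[OF T.unit_obj T.unit_obj] T.unit_tensor_obj[OF T.unit_obj]
      P.leg13_unit[OF flip_symmetry V h] P.unit_tensor[OF V V h] by simp
  then show ?thesis using P.unitary_idempotent_eq_ident[OF V u] by simp
qed

text \<open>
  An object in the image of \<open>\<iota>\<close> is a direct sum of copies of the unit, and by naturality \<open>\<eta>\<close> is
  determined on a direct sum by its values on the summands.
\<close>

lemma R_image:
  assumes A: "A \<in> Obj T"
  shows "R (io A) = \<one> (io A \<boxtimes> io V)"
proof -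
  have oA: "io A \<in> Obj D" and oV: "io V \<in> Obj D" using A V_obj by auto
  note oAV = D.tensor_obj[OF oA oV] and oU = D.unit_obj
  obtain I :: "'a set" and w where ds: "direct_sum D (io A) I (\<lambda>_. Unit D) w"
    using D.sum_of_units[OF oA] by blast
  note dsV = D.direct_sum_tensor[OF oA oV oU ds]
  have R: "R (io A) \<in> Hom D (io A \<boxtimes> io V) (io A \<boxtimes> io V)"
    using R_hom[OF io_obj[OF A]] io_tensor[OF io_obj[OF A] V_obj] io_io[OF A] by simp
  have id: "\<one> (io A \<boxtimes> io V) \<in> Hom D (io A \<boxtimes> io V) (io A \<boxtimes> io V)"
    using D.ident_hom[OF oAV] by simp
  have m: "(-1) \<odot> \<one> (io A \<boxtimes> io V) \<in> Hom D (io A \<boxtimes> io V) (io A \<boxtimes> io V)"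
    using D.scale_hom[OF oAV oAV, of "\<one> (io A \<boxtimes> io V)"] id by simp
  \<comment> \<open>Equality is proved as vanishing of the difference, which is tested on the
    summands \<open>w i \<otimes> \<one> (io V)\<close> by
    \<open>direct_sum_separating\<close>.\<close>
  have "R (io A) \<oplus> (-1) \<odot> \<one> (io A \<boxtimes> io V) = \<zero> (io A \<boxtimes> io V) (io A \<boxtimes> io V)"
  proof -
    have oUV: "Unit D \<boxtimes>\<^bsub>D\<^esub> io V \<in> Obj D" using D.tensor_obj[OF oU oV] .
    have sep: "(R (io A) \<oplus> (-1) \<odot> \<one> (io A \<boxtimes> io V)) \<cdot> (w i \<otimes> \<one> (io V))
        = \<zero> (Unit T \<boxtimes> io V) (io A \<boxtimes> io V)" if i: "i \<in> I" for i
    proof -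
      have w: "w i \<in> Hom T (Unit T) (io A)" "ia (w i) = w i"
        using ds i image_hom_fixed[of "w i"] by (auto simp: direct_sum_def)
      have wV: "w i \<otimes> \<one> (io V) \<in> Hom D (Unit D \<boxtimes>\<^bsub>D\<^esub> io V) (io A \<boxtimes>\<^bsub>D\<^esub> io V)"
        using dsV i by (simp add: direct_sum_def)
      \<comment> \<open>Naturality along \<open>w i\<close>, an arrow from the unit, replaces
        \<open>R (io A)\<close> by \<open>R (Unit T)\<close>, which is an identity.\<close>
      have "R (io A) \<cdot> (w i \<otimes> \<one> (io V)) = (w i \<otimes> \<one> (io V)) \<cdot> \<one> (io V)"
        using R_natural[OF T.unit_obj io_obj[OF A] w(1)] w(2) R_unit by simp
      also have "\<dots> = w i \<otimes> \<one> (io V)"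
        using D.ident_right[OF oUV oAV wV] D.unit_tensor_obj[OF oV] by simp
      finally have 1: "R (io A) \<cdot> (w i \<otimes> \<one> (io V)) = w i \<otimes> \<one> (io V)" .
      show ?thesis
        using D.comp_add_left[OF oUV oAV oAV wV, of "R (io A)" "(-1) \<odot> \<one> (io A \<boxtimes> io V)"] R m 1
          D.comp_scale_left[OF oUV oAV oAV wV, of "\<one> (io A \<boxtimes> io V)" "-1"] id
          D.ident_left[OF oUV oAV wV] D.add_inverse[OF oUV oAV wV] by simp
    qed
    have y: "R (io A) \<oplus> (-1) \<odot> \<one> (io A \<boxtimes> io V) \<in> Hom D (io A \<boxtimes> io V) (io A \<boxtimes> io V)"
      using D.add_hom[OF oAV oAV, of "R (io A)"] R m by simp
    show ?thesis
      using D.direct_sum_separating[OF oAV oUV dsV] y sep by simp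
  qed
  then show ?thesis
    using D.eq_of_diff_zero[OF oAV oAV, of "R (io A)" "\<one> (io A \<boxtimes> io V)"] R id by simp
qed

text \<open>The pentagon equation is naturality of \<open>\<eta>\<close> with respect to the arrow \<open>\<eta> A\<close> itself.\<close>

lemma R_representation:
  assumes A: "A \<in> Obj T"
  shows "representation P flip V (R V) A (R A)"
proof -
  note V = V_obj and iA = io_obj[OF A]
  note ob = T.tensor_obj[OF A V] T.tensor_obj[OF iA V] T.tensor_obj[OF V V]
  have P: "A \<in> Obj P" "io A \<in> Obj P" "V \<in> Obj P" using A iA V by simp_all
  have 3: "A \<boxtimes> V \<boxtimes> V \<in> Obj P" using T.tensor_obj ob V by simp
  have RA: "R A \<otimes> \<one> (io V) \<in> Hom P (A \<boxtimes> V \<boxtimes> V) (A \<boxtimes> V \<boxtimes> V)"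
    using P.tensor_hom[OF _ _ P(3,3) R_hom[OF A] P.ident_hom[OF P(3)]] ob by simp
  have RV: "\<one> (io A) \<otimes> R V \<in> Hom P (A \<boxtimes> V \<boxtimes> V) (A \<boxtimes> V \<boxtimes> V)"
    using P.tensor_hom[OF P(1,1) _ _ P.ident_hom[OF P(1)] R_hom[OF V]] ob
      T.tensor_obj_assoc[OF A V V] by simp
  have leg: "leg13 P flip A A V V V (R A) \<in> Hom P (A \<boxtimes> V \<boxtimes> V) (A \<boxtimes> V \<boxtimes> V)"
  proof -
    have VV: "flip V V \<in> Hom P (V \<boxtimes> V) (V \<boxtimes> V)"
      using flip_symmetry V by (simp add: permutation_symmetry_def unitary_def)
    then have "\<one> (io A) \<otimes> flip V V \<in> Hom P (A \<boxtimes> V \<boxtimes> V) (A \<boxtimes> V \<boxtimes> V)"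
      using P.tensor_hom[OF P(1,1) _ _ P.ident_hom[OF P(1)] VV] ob
        T.tensor_obj_assoc[OF A V V] by simp
    then show ?thesis
      using P.comp_hom[OF 3 3 3] RA by (simp add: leg13_def)
  qed
  \<comment> \<open>As \<open>R (io A)\<close> is an identity, so is its leg, and the tensor formula
    reduces \<open>R (io A \<boxtimes> V)\<close> to
    \<open>\<one> (io A) \<otimes> R V\<close>.\<close>
  have "R (io A \<boxtimes> V) = leg13 P flip (io A) (io A) V V V (R (io A)) \<cdot> (\<one> (io (io A)) \<otimes> R V)"
    using R_tensor[OF iA V] .
  also have "leg13 P flip (io A) (io A) V V V (R (io A)) = \<one> (io (A \<boxtimes> V \<boxtimes> V))"
    using P.leg13_ident[OF flip_symmetry P(2,3,3)] R_image[OF A] io_tensor ob A iA V io_io by simp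
  also have "\<one> (io (A \<boxtimes> V \<boxtimes> V)) \<cdot> (\<one> (io (io A)) \<otimes> R V) = \<one> (io A) \<otimes> R V"
    using P.ident_left[OF 3 3 RV] io_io[OF A] by simp
  finally have "(\<one> (io A) \<otimes> R V) \<cdot> (R A \<otimes> \<one> (io V))
      = (R A \<otimes> \<one> (io V)) \<cdot> (leg13 P flip A A V V V (R A) \<cdot> (\<one> (io A) \<otimes> R V))"
    using R_natural[OF ob(1,2) eta_hom[OF A]] R_tensor[OF A V] by simp
  also have "\<dots> = (R A \<otimes> \<one> (io V)) \<cdot> leg13 P flip A A V V V (R A) \<cdot> (\<one> (io A) \<otimes> R V)"
    using P.comp_assoc[OF 3 3 3 3 RV leg RA] by simp
  finally show ?thesis using A R_unitary[OF A] by (simp add: representation_def)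
qed

lemma R_multiplicative: "multiplicative_unitary P flip V (R V)"
  using R_representation[OF V_obj] by (simp add: multiplicative_unitary_def representation_def)

section \<open>The subcategory of representations isomorphic to \<open>T\<close>\<close>

text \<open>Only intertwiners of the form \<open>ia t\<close> are kept, so the subcategory need not
  be full and \<open>ia\<close> is onto its hom-sets.\<close>

definition image_rep :: "('o \<times> 'a, 'a) tensor_category" where
  "image_rep = (Rep_category P flip V (R V))
    \<lparr>Obj := (\<lambda>A. (A, R A)) ` Obj T, Hom := (\<lambda>A B. ia ` Hom T (fst A) (fst B))\<rparr>"

text \<open>\<open>R_unit\<close> and \<open>R_tensor\<close> keep the unit and the tensor products
  among the pairs \<open>(A, R A)\<close>; closure on arrows is functoriality of
  \<open>ia\<close>.\<close>

lemma image_rep_subcategory: "tensor_star_subcategory image_rep (Rep_category P flip V (R V))"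
proof -
  have hom: "ia t \<in> Hom (Rep_category P flip V (R V)) (A, R A) (B, R B)"
    if "A \<in> Obj T" "B \<in> Obj T" "t \<in> Hom T A B" for A B t
    using image_hom[OF that] R_natural[OF that] by (simp add: Rep_category_def)
  have unit: "(Unit T, \<one> (io V)) \<in> (\<lambda>A. (A, R A)) ` Obj T"
    using T.unit_obj unfolding R_unit[symmetric] by (rule imageI)
  have tensor: "(A \<boxtimes> B, leg13 P flip A A B V V (R A) \<cdot> (\<one> (io A) \<otimes> R B))
      \<in> (\<lambda>A. (A, R A)) ` Obj T" if "A \<in> Obj T" "B \<in> Obj T" for A B
    using T.tensor_obj[OF that] unfolding R_tensor[OF that, symmetric] by (rule imageI)
  have "\<one> (io A) \<in> ia ` Hom T A A" if "A \<in> Obj T" for A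
    using ia_ident[OF that] T.ident_hom[OF that] by (metis image_eqI)
  moreover have "ia s \<cdot> ia t \<in> ia ` Hom T A E"
    if "A \<in> Obj T" "B \<in> Obj T" "E \<in> Obj T" "t \<in> Hom T A B" "s \<in> Hom T B E" for A B E s t
    using ia_comp[OF that] T.comp_hom[OF that] by (metis image_eqI)
  moreover have "\<zero> (io A) (io B) \<in> ia ` Hom T A B" if "A \<in> Obj T" "B \<in> Obj T" for A B
    using ia_zero[OF that] T.zero_hom[OF that] by (metis image_eqI)
  moreover have "ia s \<oplus> ia t \<in> ia ` Hom T A B"
    if "A \<in> Obj T" "B \<in> Obj T" "s \<in> Hom T A B" "t \<in> Hom T A B" for A B s t
    using ia_add[OF that] T.add_hom[OF that] by (metis image_eqI)
  moreover have "c \<odot> ia t \<in> ia ` Hom T A B"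
    if "A \<in> Obj T" "B \<in> Obj T" "t \<in> Hom T A B" for A B t c
    using ia_scale[OF that] T.scale_hom[OF that] by (metis image_eqI)
  moreover have "(ia t)\<^sup>\<star> \<in> ia ` Hom T B A" if "A \<in> Obj T" "B \<in> Obj T" "t \<in> Hom T A B" for A B t
    using ia_adj[OF that] T.adj_hom[OF that] by (metis image_eqI)
  moreover have "ia s \<otimes> ia t \<in> ia ` Hom T (A \<boxtimes> A') (B \<boxtimes> B')"
    if "A \<in> Obj T" "B \<in> Obj T" "A' \<in> Obj T" "B' \<in> Obj T" "s \<in> Hom T A B" "t \<in> Hom T A' B'"
    for A B A' B' s t
    using ia_tensor[OF that] T.tensor_hom[OF that] by (metis image_eqI)
  ultimately show ?thesis
    unfolding tensor_star_subcategory_def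
    using hom R_representation
    by (simp add: image_rep_def Rep_category_def image_subset_iff) (intro conjI ballI unit tensor; assumption)
qed

text \<open>Faithfulness makes \<open>ia\<close> injective on hom-sets, and the first component of
  \<open>(A, R A)\<close> recovers the object.\<close>

lemma isomorphic_image_rep: "tensor_star_isomorphic T image_rep"
  unfolding tensor_star_isomorphic_def
proof (intro exI conjI ballI)
  show "tensor_star_functor T image_rep (\<lambda>A. (A, R A)) ia"
    unfolding tensor_star_functor_def
    by (simp add: image_rep_def Rep_category_def ia_ident ia_comp ia_add ia_scale ia_adj ia_tensor
        R_tensor R_unit)
  show "bij_betw (\<lambda>A. (A, R A)) (Obj T) (Obj image_rep)"
    by (simp add: image_rep_def bij_betw_def inj_on_def)
  show "bij_betw ia (Hom T A B) (Hom image_rep (A, R A) (B, R B))" if "A \<in> Obj T" "B \<in> Obj T" for A B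
    using ia_inj[OF that] by (simp add: image_rep_def bij_betw_def)
qed

end

theorem theorem2p1:
  fixes T :: "('o, 'a) tensor_category"
    and io :: "'o \<Rightarrow> 'o" and ia :: "'a \<Rightarrow> 'a" and \<theta> :: "'o \<Rightarrow> 'o \<Rightarrow> 'a"
  assumes "strict_tensor_Wstar_category T"
    and "Hilbert_functor T io ia \<theta>"
    and "\<exists>V \<eta>. right_regular_object T io ia \<theta> V \<eta>"
  shows "\<exists>(\<H> :: ('o, 'a) tensor_category) flip K V.
    Hilbert_tensor_category \<H> \<and> permutation_symmetry \<H> flip \<and>
    multiplicative_unitary \<H> flip K V \<and>
    (\<exists>S. tensor_star_subcategory S (Rep_category \<H> flip K V) \<and> tensor_star_isomorphic T S)"
proof -
  obtain V \<eta> where "right_regular_object T io ia \<theta> V \<eta>" using assms(3) by blast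
  then interpret regular_fibre_functor T io ia \<theta> V \<eta>
    using assms(1,2) by (intro regular_fibre_functor.intro regular_fibre_functor_axioms.intro)
  \<comment> \<open>The witnesses are \<open>P\<close> with \<open>flip\<close>, the Hilbert space
    indexed by the regular object \<open>V\<close>, the multiplicative unitary \<open>R V\<close>,
    and \<open>image_rep\<close> for \<open>S\<close>.\<close>
  show ?thesis
    using P.Hilbert_tensor_category_axioms flip_symmetry R_multiplicative image_rep_subcategory
      isomorphic_image_rep by blast
qed

end
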